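(* Let $\mathcal P_8$ be the unit regular octahedron and let $L$ be a landscape of $\mathcal P_8$ with origin face $F_{n_1}$ and destination face $F_{n_i}$ for some $i\in\{1,\dots,8\}$. If $L$ is not one of the landscapes $L_1,\dots,L_9$ (for some admissible labeling $(n_1,\dots,n_8)$ beginning with this $n_1$), then $L$ is not valid. Here, for an admissible labeling, $L_1$ has consecutive faces $F_{n_1},F_{n_2}$; $L_2$: $F_{n_1},F_{n_2},F_{n_5}$; $L_3$: $F_{n_1},F_{n_6},F_{n_5}$; $L_4$: $F_{n_1},F_{n_6},F_{n_5},F_{n_8}$; $L_5$: $F_{n_1},F_{n_2},F_{n_3},F_{n_8}$; $L_6$: $F_{n_1},F_{n_4},F_{n_7},F_{n_8}$; $L_7$: $F_{n_1},F_{n_6},F_{n_7},F_{n_8}$; $L_8$: $F_{n_1},F_{n_2},F_{n_5},F_{n_8}$; $L_9$: $F_{n_1},F_{n_4},F_{n_3},F_{n_8}$.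
   Context: $\mathcal P_8$ is a regular octahedron all of whose edges have length $1$, with faces labeled $F_1,\dots,F_8$ and vertices identified with the sets $\{1,4,6,7\},\{1,2,5,6\},\{1,2,3,4\},\{2,3,5,8\},\{3,4,7,8\},\{5,6,7,8\}$, where face $F_n$ is incident to a vertex $S$ iff $n\in S$ (so $F_b$ and $F_c$ are opposite iff $b+c=9$). Admissible labeling: a permutation $(n_1,\dots,n_8)$ of $(1,\dots,8)$ such that $F_{n_b}$ and $F_{n_c}$ are opposite whenever $b+c=9$, and the three faces $F_{n_2},F_{n_4},F_{n_6}$ adjacent to $F_{n_1}$ occur around $F_{n_1}$ (viewed from outside) in the same rotational order as $F_2,F_4,F_6$ occur around $F_1$. Landscape: given a net $N$ of $\mathcal P_8$, its dual graph has the faces as vertices, adjacent iff they share an edge in $N$. If $H$ is a subgraph of the dual graph that is a path on at least two vertices, the union of the corresponding faces of $N$ is a landscape with dual graph $H$; its end faces are the origin and destination faces. A (proper) sublandscape of $L$ is the landscape given by a (proper) subpath of $H$ with at least two vertices. Trail length: for points $q_1,q_2$ in a landscape $L$, embed $L$ isometrically in the plane (exterior sides up); $|T_L(q_1,q_2)|$ is the length of the straight segment joining their images if it lies inside the image of $L$, and $\infty$ otherwise. Valid landscape: a landscape $L_i$ is valid if there exist points $p_1,p_2\in L_i$ such that for every other landscape $L_j$ containing $p_1,p_2$ we have $|T_{L_i}(p_1,p_2)|\le|T_{L_j}(p_1,p_2)|$, and if equality holds then $L_i$ does not contain $L_j$ as a sublandscape. *)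

theory Defs
  imports "HOL-Analysis.Analysis" "HOL-Combinatorics.Permutations"
begin

text \<open>
  The octahedron is centred at the origin. Faces are labelled by 1..8, and a vertex is identified
  with the set of labels of the faces incident to it. The mirror image of the position function
  below would serve equally well: it leads to the same admissible labelings.
\<close>

definition octa_vertices :: "nat set set" where
  "octa_vertices =
     {{1,4,6,7}, {1,2,5,6}, {1,2,3,4}, {2,3,5,8}, {3,4,7,8}, {5,6,7,8}}"

definition vertex_pos :: "nat set \<Rightarrow> real ^ 3" where
  "vertex_pos S = (1 / sqrt 2) *\<^sub>R
     (if S = {1,4,6,7} then vector [1, 0, 0]
      else if S = {1,2,5,6} then vector [0, 1, 0]
      else if S = {1,2,3,4} then vector [0, 0, 1]
      else if S = {2,3,5,8} then vector [-1, 0, 0]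
      else if S = {3,4,7,8} then vector [0, -1, 0]
      else if S = {5,6,7,8} then vector [0, 0, -1]
      else 0)"

definition face :: "nat \<Rightarrow> (real ^ 3) set" where
  "face f = convex hull (vertex_pos ` {S \<in> octa_vertices. f \<in> S})"

text \<open>Since the octahedron is centred at 0, the centroid of a face is also an outward normal.\<close>

definition centroid :: "nat \<Rightarrow> real ^ 3" where
  "centroid f = (1 / 3) *\<^sub>R (\<Sum>S | S \<in> octa_vertices \<and> f \<in> S. vertex_pos S)"

definition adjacent :: "nat \<Rightarrow> nat \<Rightarrow> bool" where
  "adjacent f g \<longleftrightarrow> card {S \<in> octa_vertices. f \<in> S \<and> g \<in> S} = 2"

definition opposite :: "nat \<Rightarrow> nat \<Rightarrow> bool" where
  "opposite f g \<longleftrightarrow> {S \<in> octa_vertices. f \<in> S \<and> g \<in> S} = {}"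

lemma opposite_iff:
  assumes "b \<in> {1..8}" "c \<in> {1..8}"
  shows "opposite b c \<longleftrightarrow> b + c = 9"
proof -
  have range: "x = 1 \<or> x = 2 \<or> x = 3 \<or> x = 4 \<or> x = 5 \<or> x = 6 \<or> x = 7 \<or> x = 8"
    if "x \<in> {1..8}" for x :: nat
    using that by (auto simp: numeral_eq_Suc le_Suc_eq)
  have "opposite b c \<longleftrightarrow> (\<forall>S\<in>octa_vertices. \<not> (b \<in> S \<and> c \<in> S))"
    by (auto simp: opposite_def)
  then show ?thesis
    using range[OF assms(1)] range[OF assms(2)]
    by (elim disjE) (simp_all add: octa_vertices_def)
qed

text \<open>The faces g, h, k occur counterclockwise around f, viewed from outside.\<close>

definition ccw_around :: "nat \<Rightarrow> nat \<Rightarrow> nat \<Rightarrow> nat \<Rightarrow> bool" where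
  "ccw_around f g h k \<longleftrightarrow>
     cross3 (centroid h - centroid g) (centroid k - centroid g) \<bullet> centroid f > 0"

definition admissible :: "(nat \<Rightarrow> nat) \<Rightarrow> bool" where
  "admissible n \<longleftrightarrow>
     n permutes {1..8} \<and>
     (\<forall>b\<in>{1..8}. \<forall>c\<in>{1..8}. b + c = 9 \<longrightarrow> opposite (n b) (n c)) \<and>
     adjacent (n 1) (n 2) \<and> adjacent (n 1) (n 4) \<and> adjacent (n 1) (n 6) \<and>
     (ccw_around (n 1) (n 2) (n 4) (n 6) \<longleftrightarrow> ccw_around 1 2 4 6)"

text \<open>
  A planar layout of a set \<open>Fs\<close> of faces in which the edges of the octahedron between the pairs
  of faces in \<open>E\<close> are left uncut: every face is placed isometrically with its exterior side up
  (triples that are counterclockwise seen from outside stay counterclockwise), faces joined along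
  an uncut edge agree on it, and distinct faces do not overlap.
\<close>

definition layout :: "nat set \<Rightarrow> nat set set \<Rightarrow> (nat \<Rightarrow> real ^ 3 \<Rightarrow> complex) \<Rightarrow> bool" where
  "layout Fs E \<phi> \<longleftrightarrow>
     (\<forall>f\<in>Fs. \<forall>x\<in>face f. \<forall>y\<in>face f. dist (\<phi> f x) (\<phi> f y) = dist x y) \<and>
     (\<forall>f\<in>Fs. \<forall>x\<in>face f. \<forall>y\<in>face f. \<forall>z\<in>face f.
        cross3 (y - x) (z - x) \<bullet> centroid f > 0 \<longrightarrow>
        Im (cnj (\<phi> f y - \<phi> f x) * (\<phi> f z - \<phi> f x)) > 0) \<and>
     (\<forall>f g. {f, g} \<in> E \<longrightarrow> (\<forall>x \<in> face f \<inter> face g. \<phi> f x = \<phi> g x)) \<and>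
     (\<forall>f\<in>Fs. \<forall>g\<in>Fs. f \<noteq> g \<longrightarrow> interior (\<phi> f ` face f) \<inter> interior (\<phi> g ` face g) = {})"

text \<open>
  A net is given by the edge set of its dual graph, which is a spanning tree (connected, with
  8 vertices and 7 edges) of the face adjacency graph that can be laid out in the plane.
\<close>

definition net :: "nat set set \<Rightarrow> bool" where
  "net N \<longleftrightarrow>
     N \<subseteq> {{f, g} | f g. f \<in> {1..8} \<and> g \<in> {1..8} \<and> adjacent f g} \<and>
     (\<forall>f\<in>{1..8}. \<forall>g\<in>{1..8}. (f, g) \<in> {(a, b). {a, b} \<in> N}\<^sup>*) \<and>
     card N = 7 \<and>
     (\<exists>\<phi>. layout {1..8} N \<phi>)"

definition path_edges :: "nat list \<Rightarrow> nat set set" where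
  "path_edges fs = (\<lambda>(f, g). {f, g}) ` set (zip fs (tl fs))"

text \<open>
  A landscape is represented by the edge set of its dual graph, an undirected path with at least
  one edge. Thus a path and its reversal give the same landscape, the faces of the landscape
  \<open>L\<close> are the elements of \<open>\<Union>L\<close>, and the subpaths with at least two vertices are exactly
  the subsets that are landscapes.
\<close>

definition landscape :: "nat set set \<Rightarrow> bool" where
  "landscape L \<longleftrightarrow>
     (\<exists>N fs. net N \<and> distinct fs \<and> length fs \<ge> 2 \<and> path_edges fs \<subseteq> N \<and> L = path_edges fs)"

definition landscape_from_to :: "nat set set \<Rightarrow> nat \<Rightarrow> nat \<Rightarrow> bool" where
  "landscape_from_to L a b \<longleftrightarrow>
     landscape L \<and>
     (\<exists>fs. distinct fs \<and> length fs \<ge> 2 \<and> L = path_edges fs \<and> hd fs = a \<and> last fs = b)"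

definition sublandscape :: "nat set set \<Rightarrow> nat set set \<Rightarrow> bool" where
  "sublandscape L' L \<longleftrightarrow> landscape L' \<and> landscape L \<and> L' \<subseteq> L"

definition region :: "nat set set \<Rightarrow> (real ^ 3) set" where
  "region L = (\<Union>f\<in>\<Union>L. face f)"

text \<open>
  A point on a cut edge has several images in the layout of a landscape, one for each face of the
  landscape containing it; the trail length is the least length over all choices of images (all
  layouts of a landscape are congruent, and the infimum of the empty set is \<open>\<infinity>\<close>).
\<close>

definition trail_length :: "nat set set \<Rightarrow> real ^ 3 \<Rightarrow> real ^ 3 \<Rightarrow> ereal" where
  "trail_length L p q =
     Inf {ereal (dist (\<phi> f p) (\<phi> g q)) | \<phi> f g.
            layout (\<Union>L) L \<phi> \<and> f \<in> \<Union>L \<and> g \<in> \<Union>L \<and> p \<in> face f \<and> q \<in> face g \<and>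
            closed_segment (\<phi> f p) (\<phi> g q) \<subseteq> (\<Union>h\<in>\<Union>L. \<phi> h ` face h)}"

definition valid :: "nat set set \<Rightarrow> bool" where
  "valid L \<longleftrightarrow>
     landscape L \<and>
     (\<exists>p1\<in>region L. \<exists>p2\<in>region L. \<forall>L'.
        landscape L' \<and> L' \<noteq> L \<and> p1 \<in> region L' \<and> p2 \<in> region L' \<longrightarrow>
          trail_length L p1 p2 \<le> trail_length L' p1 p2 \<and>
          (trail_length L p1 p2 = trail_length L' p1 p2 \<longrightarrow> \<not> sublandscape L' L))"

definition special_landscape :: "(nat \<Rightarrow> nat) \<Rightarrow> nat \<Rightarrow> nat set set" where
  "special_landscape n k = path_edges (map n
     ([[1, 2],
       [1, 2, 5],
       [1, 6, 5],
       [1, 6, 5, 8],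
       [1, 2, 3, 8],
       [1, 4, 7, 8],
       [1, 6, 7, 8],
       [1, 2, 5, 8],
       [1, 4, 3, 8]] ! (k - 1)))"

end

theory Submission
  imports Defs
begin

text \<open>
  The face adjacency graph is the cube graph: a face is a sign vector, and crossing an edge flips
  one sign, so a path of faces is a start face together with a word of axes. Unfolding along the
  word replaces, at each letter \<open>k\<close>, the corner on axis \<open>k\<close> by its reflection in the opposite edge,
  hence all corners land on a triangular lattice and their mutual distances depend on the word only.

  If the word has no repeated letter, the unfolded landscape is a rhombus, trapezoid or
  parallelogram; it is convex, so every segment between two of its points is a trail. These are
  exactly the landscapes \<open>L\<^sub>1,\<dots>,L\<^sub>9\<close>. Now let the word have a repeated letter.
  For points \<open>p\<close>, \<open>q\<close> of the two end faces, the difference of the squared distances obtained from two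
  paths with the same end faces is affine in the barycentric coordinates of \<open>p\<close> and of \<open>q\<close>, so
  comparing the two distances amounts to comparing them at the nine pairs of corners. This finite
  check always yields a repetition-free word which is at least as good at every pair of corners and
  strictly better at the pair of corners lying on neither the first nor the last crossed edge.
  Hence it is strictly better for \<open>p\<close>, \<open>q\<close>, unless \<open>p\<close> or \<open>q\<close> lies on such an edge, in which case an
  end face of the path can be dropped. Only the distance of the end points in the layout enters;
  whether the segment between them stays inside the original landscape is irrelevant.
\<close>

section \<open>Paths of faces as words of axes\<close>

datatype axis3 = X | Y | Z

text \<open>Faces are labelled from 1, so the entries at index 0 are never used.\<close>

fun flip :: "nat \<Rightarrow> axis3 \<Rightarrow> nat" where
  "flip f X = [0,2,1,4,3,6,5,8,7] ! f"
| "flip f Y = [0,4,3,2,1,8,7,6,5] ! f"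
| "flip f Z = [0,6,5,8,7,2,1,4,3] ! f"

fun walk :: "nat \<Rightarrow> axis3 list \<Rightarrow> nat list" where
  "walk f [] = [f]"
| "walk f (k # w) = f # walk (flip f k) w"

definition endpoint :: "nat \<Rightarrow> axis3 list \<Rightarrow> nat" where
  "endpoint f w = foldl flip f w"

fun proj :: "axis3 \<Rightarrow> 'a \<times> 'a \<times> 'a \<Rightarrow> 'a" where
  "proj X (p, q, r) = p"
| "proj Y (p, q, r) = q"
| "proj Z (p, q, r) = r"

text \<open>Unfolding across an edge is a point reflection of the remaining corner in the edge's midpoint.\<close>

fun step :: "axis3 \<Rightarrow> 'a \<times> 'a \<times> 'a \<Rightarrow> ('a::ab_group_add) \<times> 'a \<times> 'a" where
  "step X (p, q, r) = (q + r - p, q, r)"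
| "step Y (p, q, r) = (p, p + r - q, r)"
| "step Z (p, q, r) = (p, q, p + q - r)"

text \<open>
  Coordinates of the start triangle with respect to two of its sides. These are unit vectors at an
  angle of 60 degrees, so the vector with coordinates \<open>x\<close>, \<open>y\<close> has squared length \<open>x\<^sup>2 + x y + y\<^sup>2\<close>.
\<close>

definition lattice_x :: "int \<times> int \<times> int" where "lattice_x = (0, 1, 0)"
definition lattice_y :: "int \<times> int \<times> int" where "lattice_y = (0, 0, 1)"

text \<open>Everything stays in \<open>int\<close>, with products written out, so that corner
  distances can be compared by evaluation.\<close>

definition corner_sqdist :: "axis3 list \<Rightarrow> axis3 \<Rightarrow> axis3 \<Rightarrow> int" where
  "corner_sqdist w i j =
    (let dx = proj i lattice_x - proj j (fold step w lattice_x); dy = proj i lattice_y - proj j (fold step w lattice_y)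
     in dx * dx + dx * dy + dy * dy)"

text \<open>Words grow at the front: a suffix of a self-avoiding walk is self-avoiding, and by the
  symmetry of the cube graph it may again be started at face 1. So the enumeration can be pruned at
  every length.\<close>

fun words :: "nat \<Rightarrow> axis3 list list" where
  "words 0 = [[]]"
| "words (Suc n) =
     filter (\<lambda>w. distinct (walk 1 w)) (concat (map (\<lambda>w. [X # w, Y # w, Z # w]) (words n)))"

text \<open>In the first face the corner on axis \<open>hd w\<close> is the one off the first
  crossed edge, and in the last face the corner on axis \<open>last w\<close> is the one off the
  last crossed edge; strictness is demanded at this pair.\<close>

definition better :: "axis3 list \<Rightarrow> axis3 list \<Rightarrow> bool" where
  "better w' w \<longleftrightarrow> endpoint 1 w' = endpoint 1 w \<and>
     list_all (\<lambda>i. list_all (\<lambda>j. corner_sqdist w' i j \<le> corner_sqdist w i j) [X, Y, Z]) [X, Y, Z] \<and>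
     corner_sqdist w' (hd w) (last w) < corner_sqdist w (hd w) (last w)"

definition repetition_free_words :: "axis3 list list" where
  "repetition_free_words = [[X], [Y], [Z], [X,Y], [X,Z], [Y,X], [Y,Z], [Z,X], [Z,Y],
     [X,Y,Z], [X,Z,Y], [Y,X,Z], [Y,Z,X], [Z,X,Y], [Z,Y,X]]"

text \<open>The first disjunct also covers the empty word, for which \<open>hd\<close> and
  \<open>last\<close> in \<open>better\<close> are unspecified.\<close>

definition improvable :: "axis3 list \<Rightarrow> bool" where
  "improvable w \<longleftrightarrow> distinct w \<or> list_ex (\<lambda>w'. better w' w) repetition_free_words"

text \<open>A walk without repeated faces visits at most 8 faces, so its word has at most 7 letters;
  the finitely many words are checked by evaluation.\<close>

lemma words_improvable: "\<forall>n \<in> set [0..<8]. list_all improvable (words n)"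
  by code_simp

section \<open>Symmetries of the face graph\<close>

definition faces :: "nat set" where "faces = {1..8}"

lemma faces_eq: "faces = {1,2,3,4,5,6,7,8}"
  by (auto simp: faces_def)

lemma face_cases:
  assumes "f \<in> faces"
  obtains "f = 1" | "f = 2" | "f = 3" | "f = 4" | "f = 5" | "f = 6" | "f = 7" | "f = 8"
  using assms unfolding faces_eq by blast

lemma flip_in [simp]: "f \<in> faces \<Longrightarrow> flip f k \<in> faces"
  by (erule face_cases; cases k; simp add: faces_def)

lemma flip_flip [simp]: "f \<in> faces \<Longrightarrow> flip (flip f k) k = f"
  by (erule face_cases; cases k; simp)

lemma flip_commute: "f \<in> faces \<Longrightarrow> flip (flip f k) j = flip (flip f j) k"
  by (erule face_cases; cases k; cases j; simp)

lemma flip_inj: "f \<in> faces \<Longrightarrow> flip f j = flip f k \<longleftrightarrow> j = k"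
  by (erule face_cases; cases k; cases j; simp)

declare flip.simps [simp del]

lemma one_in_faces [simp]: "1 \<in> faces" "Suc 0 \<in> faces"
  by (simp_all add: faces_def)

lemma endpoint_simps [simp]:
  "endpoint f [] = f" "endpoint f (k # w) = endpoint (flip f k) w"
  "endpoint f (v @ w) = endpoint (endpoint f v) w"
  by (simp_all add: endpoint_def)

lemma endpoint_in [simp]: "f \<in> faces \<Longrightarrow> endpoint f w \<in> faces"
  by (induction w arbitrary: f) simp_all

lemma endpoint_flip: "f \<in> faces \<Longrightarrow> endpoint (flip f k) w = flip (endpoint f w) k"
  by (induction w arbitrary: f) (simp_all add: flip_commute[of _ k])

lemma walk_not_Nil [simp]: "walk f w \<noteq> []"
  by (cases w) auto

lemma hd_walk [simp]: "hd (walk f w) = f"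
  by (cases w) auto

lemma last_walk [simp]: "last (walk f w) = endpoint f w"
  by (induction w arbitrary: f) auto

lemma length_walk [simp]: "length (walk f w) = Suc (length w)"
  by (induction w arbitrary: f) auto

lemma set_walk: "f \<in> faces \<Longrightarrow> set (walk f w) \<subseteq> faces"
  by (induction w arbitrary: f) simp_all

lemma walk_append: "walk f (v @ w) = walk f v @ tl (walk (endpoint f v) w)"
proof (induction v arbitrary: f)
  case Nil then show ?case by (cases w) auto
qed simp

text \<open>Flips commute, so moving the start face along \<open>u\<close> moves every face of the
  walk along \<open>u\<close>.\<close>

lemma walk_endpoint:
  "f \<in> faces \<Longrightarrow> walk (endpoint f u) w = map (\<lambda>h. endpoint h u) (walk f w)"
  by (induction w arbitrary: f)
     (simp_all add: endpoint_flip[symmetric])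

lemma inj_flip: "inj_on (\<lambda>f. flip f k) faces"
  by (rule inj_on_inverseI[where g = "\<lambda>f. flip f k"]) (simp)

lemma inj_endpoint: "inj_on (\<lambda>f. endpoint f u) faces"
proof (induction u)
  case (Cons k u)
  show ?case
  proof (rule inj_onI)
    fix f g :: nat
    assume "f \<in> faces" "g \<in> faces" "endpoint f (k # u) = endpoint g (k # u)"
    then have "flip f k = flip g k"
      using inj_onD[OF Cons, of "flip f k" "flip g k"] by (simp)
    with \<open>f \<in> faces\<close> \<open>g \<in> faces\<close> show "f = g"
      using inj_onD[OF inj_flip] by blast
  qed
qed simp

lemma ex_endpoint:
  assumes "f \<in> faces"
  shows "\<exists>u. f = endpoint 1 u"
proof -
  \<comment> \<open>One word for each subset of the axes, that is, for each sign vector.\<close>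
  have "f \<in> (endpoint 1) ` {[], [X], [X,Y], [Y], [X,Z], [Z], [Y,Z], [X,Y,Z]}"
    using assms by (cases rule: face_cases) (simp_all add: flip.simps)
  then show ?thesis by blast
qed

text \<open>Moving along a fixed word is injective on faces and every face is reached from face 1,
  so self-avoidance is a property of the word alone.\<close>

lemma distinct_walk_1:
  assumes "f \<in> faces"
  shows "distinct (walk f w) \<longleftrightarrow> distinct (walk 1 w)"
proof -
  obtain u where "f = endpoint 1 u" using ex_endpoint[OF assms] by blast
  moreover have "inj_on (\<lambda>h. endpoint h u) (set (walk 1 w))"
    using inj_endpoint set_walk[of 1 w] by (rule inj_on_subset) simp
  ultimately show ?thesis
    by (simp add: walk_endpoint distinct_map)
qed

text \<open>With \<open>f = endpoint 1 u\<close>, commutativity gives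
  \<open>endpoint f x = endpoint (endpoint 1 x) u\<close>, and moving along \<open>u\<close> is
  injective.\<close>

lemma endpoint_eq_1:
  assumes f: "f \<in> faces"
  shows "endpoint f v = endpoint f w \<longleftrightarrow> endpoint 1 v = endpoint 1 w"
proof -
  obtain u where u: "f = endpoint 1 u" using ex_endpoint[OF assms] by blast
  have "endpoint f x = endpoint (endpoint 1 x) u" for x
    unfolding u
    by (induction x rule: rev_induct)
       (simp_all add: endpoint_flip[symmetric])
  then show ?thesis
    using inj_onD[OF inj_endpoint[of u], of "endpoint 1 v" "endpoint 1 w"]
    by auto
qed

lemma distinct_walk_words: "distinct (walk 1 w) \<Longrightarrow> w \<in> set (words (length w))"
proof (induction w)
  case (Cons k w)
  then have "distinct (walk 1 w)"
    using distinct_walk_1[of "flip 1 k" w] flip_in[of 1 k] by simp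
  then have "w \<in> set (words (length w))" by (rule Cons.IH)
  moreover have "k # w \<in> {X # w, Y # w, Z # w}" by (cases k) auto
  ultimately show ?case using Cons.prems by auto
qed simp

text \<open>Transfers the evaluated check from face 1 to an arbitrary start face.\<close>

lemma ex_better:
  assumes f: "f \<in> faces" and d: "distinct (walk f w)" and nd: "\<not> distinct w"
  obtains w' where "w' \<noteq> []" "distinct w'" "endpoint f w' = endpoint f w"
    "\<And>i j. corner_sqdist w' i j \<le> corner_sqdist w i j" "corner_sqdist w' (hd w) (last w) < corner_sqdist w (hd w) (last w)"
proof -
  have "length (walk f w) \<le> 8"
    using card_mono[OF _ set_walk[OF f, of w]] distinct_card[OF d] by (simp add: faces_def)
  then have "length w \<in> set [0..<8]" by simp
  then have "list_all improvable (words (length w))"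
    using words_improvable by blast
  moreover have "w \<in> set (words (length w))"
    using d distinct_walk_1[OF f] distinct_walk_words by blast
  ultimately have "improvable w" by (simp add: list_all_iff)
  then obtain w' where w': "w' \<in> set repetition_free_words" "better w' w"
    using nd by (auto simp: improvable_def list_ex_iff)
  show thesis
  proof (rule that[of w'])
    show "w' \<noteq> []" "distinct w'" using w'(1) by (auto simp: repetition_free_words_def)
    show "endpoint f w' = endpoint f w"
      using w'(2) endpoint_eq_1[OF f] by (simp add: better_def)
    show "corner_sqdist w' i j \<le> corner_sqdist w i j" for i j
      using w'(2) by (cases i; cases j; simp add: better_def)
    show "corner_sqdist w' (hd w) (last w) < corner_sqdist w (hd w) (last w)"
      using w'(2) by (simp add: better_def)
  qed
qed

section \<open>Barycentric coordinates on a face\<close>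

lemma UNIV_ax: "(UNIV :: axis3 set) = {X, Y, Z}"
  using axis3.exhaust by auto

instance axis3 :: finite
  by standard (simp add: UNIV_ax)

lemma sum_ax: "(\<Sum>k\<in>UNIV. h k) = h X + h Y + h Z"
  by (simp add: UNIV_ax add.assoc)

lemma all_ax: "(\<forall>k. P k) \<longleftrightarrow> P X \<and> P Y \<and> P Z"
proof -
  have "(\<forall>k\<in>UNIV. P k) \<longleftrightarrow> P X \<and> P Y \<and> P Z" unfolding UNIV_ax by blast
  then show ?thesis by simp
qed

fun idx :: "axis3 \<Rightarrow> 3" where
  "idx X = 1" | "idx Y = 2" | "idx Z = 3"

declare idx.simps [simp del]

text \<open>The sign vector of a face; the three sets are the vertices on the positive
  half-axes.\<close>

definition axis_sign :: "nat \<Rightarrow> axis3 \<Rightarrow> real" where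
  "axis_sign f k = (if f \<in> (case k of X \<Rightarrow> {1,4,6,7} | Y \<Rightarrow> {1,2,5,6} | Z \<Rightarrow> {1,2,3,4}) then 1 else -1)"

definition corner :: "nat \<Rightarrow> axis3 \<Rightarrow> real ^ 3" where
  "corner f k = (axis_sign f k / sqrt 2) *\<^sub>R axis (idx k) 1"

text \<open>The corners of a face are orthogonal vectors of length \<open>1 / sqrt 2\<close>, so
  barycentric coordinates are rescaled Cartesian coordinates.\<close>

definition bary :: "nat \<Rightarrow> real ^ 3 \<Rightarrow> axis3 \<Rightarrow> real" where
  "bary f x k = sqrt 2 * axis_sign f k * x $ idx k"

lemma axis_sign_flip: "f \<in> faces \<Longrightarrow> axis_sign (flip f k) j = (if j = k then - axis_sign f j else axis_sign f j)"
  by (erule face_cases; cases k; cases j; simp add: flip.simps axis_sign_def)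

lemma axis_sign_sq [simp]: "axis_sign f k * axis_sign f k = 1"
  by (simp add: axis_sign_def)

lemma axis_sign_sq' [simp]: "axis_sign f k * (axis_sign f k * x) = x"
  by (simp add: axis_sign_def)

lemma idx_eq [simp]: "idx j = idx k \<longleftrightarrow> j = k"
  by (cases j; cases k; simp add: idx.simps)

lemma vec3_eqI:
  assumes "\<And>k. x $ idx k = y $ idx k"
  shows "x = (y :: real ^ 3)"
  using assms[of X] assms[of Y] assms[of Z] by (simp add: vec_eq_iff forall_3 idx.simps)

definition vertex_set :: "nat \<Rightarrow> axis3 \<Rightarrow> nat set" where
  "vertex_set f k = (case k of
      X \<Rightarrow> if f \<in> {1,4,6,7} then {1,4,6,7} else {2,3,5,8}
    | Y \<Rightarrow> if f \<in> {1,2,5,6} then {1,2,5,6} else {3,4,7,8}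
    | Z \<Rightarrow> if f \<in> {1,2,3,4} then {1,2,3,4} else {5,6,7,8})"

lemma octa_vertices_face:
  assumes "f \<in> faces"
  shows "{S \<in> octa_vertices. f \<in> S} = {vertex_set f X, vertex_set f Y, vertex_set f Z}"
proof -
  have *: "{S \<in> insert B A. f \<in> S} = (if f \<in> B then insert B {S \<in> A. f \<in> S} else {S \<in> A. f \<in> S})"
    for B A by auto
  show ?thesis
    using assms unfolding octa_vertices_def *
    by (cases rule: face_cases) (simp_all add: vertex_set_def insert_commute)
qed

lemma vset_inj: "f \<in> faces \<Longrightarrow> vertex_set f i = vertex_set f j \<longleftrightarrow> i = j"
proof -
  show "f \<in> faces \<Longrightarrow> ?thesis"
    by (erule face_cases; cases i; cases j) (simp_all add: vertex_set_def set_eq_subset)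
qed

lemma vertex_pos_eqs:
  "vertex_pos {1,4,6,7} = (1 / sqrt 2) *\<^sub>R vector [1, 0, 0]"
  "vertex_pos {1,2,5,6} = (1 / sqrt 2) *\<^sub>R vector [0, 1, 0]"
  "vertex_pos {1,2,3,4} = (1 / sqrt 2) *\<^sub>R vector [0, 0, 1]"
  "vertex_pos {2,3,5,8} = (1 / sqrt 2) *\<^sub>R vector [-1, 0, 0]"
  "vertex_pos {3,4,7,8} = (1 / sqrt 2) *\<^sub>R vector [0, -1, 0]"
  "vertex_pos {5,6,7,8} = (1 / sqrt 2) *\<^sub>R vector [0, 0, -1]"
  by (simp_all add: vertex_pos_def set_eq_subset)

lemma vertex_pos_vset: "vertex_pos (vertex_set f k) = corner f k"
proof (rule vec3_eqI)
  fix j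
  show "vertex_pos (vertex_set f k) $ idx j = corner f k $ idx j"
    by (cases k; cases j)
       (simp_all add: vertex_pos_eqs[simplified] vertex_set_def corner_def axis_sign_def axis_def idx.simps del: insert_iff)
qed

lemma corner_nth: "corner f k $ idx j = (if j = k then axis_sign f k / sqrt 2 else 0)"
  by (simp add: corner_def axis_def)

lemma bary_corner [simp]: "bary f (corner f k) j = (if j = k then 1 else 0)"
  by (simp add: bary_def corner_nth)

lemma bary_expand: "x = (\<Sum>k\<in>UNIV. bary f x k *\<^sub>R corner f k)"
  by (rule vec3_eqI) (simp add: sum_component corner_nth bary_def if_distrib mult.assoc cong: if_cong)

lemma face_iff:
  assumes f: "f \<in> faces"
  shows "x \<in> face f \<longleftrightarrow> (\<forall>k. 0 \<le> bary f x k) \<and> (\<Sum>k\<in>UNIV. bary f x k) = 1"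
proof -
  have "vertex_pos ` {S \<in> octa_vertices. f \<in> S} = {corner f X, corner f Y, corner f Z}"
    by (simp add: octa_vertices_face[OF f] vertex_pos_vset)
  then have "face f = {u *\<^sub>R corner f X + v *\<^sub>R corner f Y + w *\<^sub>R corner f Z | u v w.
      0 \<le> u \<and> 0 \<le> v \<and> 0 \<le> w \<and> u + v + w = 1}"
    by (simp add: face_def convex_hull_3)
  then have *: "x \<in> face f \<longleftrightarrow> (\<exists>u v w. x = u *\<^sub>R corner f X + v *\<^sub>R corner f Y + w *\<^sub>R corner f Z \<and>
      0 \<le> u \<and> 0 \<le> v \<and> 0 \<le> w \<and> u + v + w = 1)"
    by blast
  have b: "bary f (u *\<^sub>R corner f X + v *\<^sub>R corner f Y + w *\<^sub>R corner f Z) k =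
      (case k of X \<Rightarrow> u | Y \<Rightarrow> v | Z \<Rightarrow> w)" for u v w k
    by (cases k) (simp_all add: bary_def corner_nth)
  show ?thesis
  proof
    assume "x \<in> face f"
    then show "(\<forall>k. 0 \<le> bary f x k) \<and> (\<Sum>k\<in>UNIV. bary f x k) = 1"
      unfolding * by (auto simp: b sum_ax all_ax)
  next
    assume "(\<forall>k. 0 \<le> bary f x k) \<and> (\<Sum>k\<in>UNIV. bary f x k) = 1"
    then show "x \<in> face f"
      unfolding * using bary_expand[of x f] unfolding sum_ax by blast
  qed
qed

lemma centroid_nth: "f \<in> faces \<Longrightarrow> centroid f $ idx k = axis_sign f k / (3 * sqrt 2)"
proof -
  assume f: "f \<in> faces"
  have "centroid f = (1/3) *\<^sub>R (corner f X + corner f Y + corner f Z)"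
    unfolding centroid_def octa_vertices_face[OF f]
    by (simp add: vset_inj[OF f] vertex_pos_vset add.assoc)
  then show ?thesis
    by (cases k) (simp_all add: corner_nth)
qed

text \<open>Common corners correspond to the axes on which the sign vectors agree, and there are two
  of them exactly if one sign differs.\<close>

lemma adjacent_iff:
  assumes "f \<in> faces" "g \<in> faces"
  shows "adjacent f g \<longleftrightarrow> (\<exists>k. g = flip f k)"
proof -
  have "{S \<in> octa_vertices. f \<in> S \<and> g \<in> S} = {S \<in> vertex_set f ` UNIV. g \<in> S}"
    using octa_vertices_face[OF assms(1)] by (auto simp: UNIV_ax)
  also have "\<dots> = vertex_set f ` {k. g \<in> vertex_set f k}"
    by blast
  finally have "card {S \<in> octa_vertices. f \<in> S \<and> g \<in> S} = card {k. g \<in> vertex_set f k}"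
    using vset_inj[OF assms(1)] by (simp add: card_image inj_on_def)
  moreover have "{k. g \<in> vertex_set f k} = (if g \<in> vertex_set f X then {X} else {}) \<union>
      (if g \<in> vertex_set f Y then {Y} else {}) \<union> (if g \<in> vertex_set f Z then {Z} else {})"
    (is "?A = ?B")
  proof (rule set_eqI)
    show "k \<in> ?A \<longleftrightarrow> k \<in> ?B" for k by (cases k) auto
  qed
  moreover have "(\<exists>k. g = flip f k) \<longleftrightarrow> g \<in> {flip f X, flip f Y, flip f Z}"
    using all_ax[of "\<lambda>k. g \<noteq> flip f k"] by blast
  ultimately show ?thesis
    unfolding adjacent_def
    using assms by (elim face_cases) (simp_all add: vertex_set_def flip.simps)
qed

section \<open>Distances in a layout\<close>

text \<open>Leibniz's formula, the triangle version of Stewart's theorem: the correction term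
  involves only the sides of the triangle, not \<open>z\<close>.\<close>

lemma dist_sq_bary3:
  fixes z A B C :: "'a::real_inner"
  assumes "a + b + c = 1"
  shows "(dist z (a *\<^sub>R A + b *\<^sub>R B + c *\<^sub>R C))\<^sup>2 =
    a * (dist z A)\<^sup>2 + b * (dist z B)\<^sup>2 + c * (dist z C)\<^sup>2 -
    (a * b * (dist A B)\<^sup>2 + b * c * (dist B C)\<^sup>2 + c * a * (dist C A)\<^sup>2)"
proof -
  define u v w where "u = z - A" "v = z - B" "w = z - C"
  note uvw = this
  have c: "c = 1 - a - b" using assms by simp
  have e1: "z - (a *\<^sub>R A + b *\<^sub>R B + c *\<^sub>R C) = a *\<^sub>R u + b *\<^sub>R v + c *\<^sub>R w"
    by (simp add: uvw c algebra_simps)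
  have e2: "A - B = v - u" "B - C = w - v" "C - A = u - w"
    by (simp_all add: uvw)
  show ?thesis
    unfolding dist_norm power2_norm_eq_inner e1 e2 unfolding uvw[symmetric]
    by (simp add: c inner_add_left inner_add_right inner_diff_left inner_diff_right
        inner_commute[of v u] inner_commute[of w u] inner_commute[of w v] algebra_simps)
qed

text \<open>By the distance formula, the distance between the two sides is computed from distances
  that the map preserves, so it equals the distance of the point to itself.\<close>

lemma isometry_bary3:
  fixes \<psi> :: "'a::real_inner \<Rightarrow> 'b::real_inner"
  assumes iso: "\<And>x y. x \<in> S \<Longrightarrow> y \<in> S \<Longrightarrow> dist (\<psi> x) (\<psi> y) = dist x y"
    and S: "A \<in> S" "B \<in> S" "C \<in> S" "a *\<^sub>R A + b *\<^sub>R B + c *\<^sub>R C \<in> S" and abc: "a + b + c = 1"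
  shows "\<psi> (a *\<^sub>R A + b *\<^sub>R B + c *\<^sub>R C) = a *\<^sub>R \<psi> A + b *\<^sub>R \<psi> B + c *\<^sub>R \<psi> C"
proof -
  let ?x = "a *\<^sub>R A + b *\<^sub>R B + c *\<^sub>R C"
  have "(dist (\<psi> ?x) (a *\<^sub>R \<psi> A + b *\<^sub>R \<psi> B + c *\<^sub>R \<psi> C))\<^sup>2 = (dist ?x ?x)\<^sup>2"
    unfolding dist_sq_bary3[OF abc] by (simp only: iso S)
  then show ?thesis by simp
qed

lemma inner_corner: "corner f i \<bullet> corner f j = (if i = j then 1 / 2 else 0)"
  by (simp add: corner_def inner_axis_axis)

lemma dist_corner: "i \<noteq> j \<Longrightarrow> dist (corner f i) (corner f j) = 1"
  by (simp add: dist_norm norm_eq_sqrt_inner inner_diff_left inner_diff_right inner_corner)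

lemma corner_in_face [simp]: "f \<in> faces \<Longrightarrow> corner f k \<in> face f"
  by (simp add: face_iff)

lemma corner_flip: "f \<in> faces \<Longrightarrow> j \<noteq> k \<Longrightarrow> corner (flip f k) j = corner f j"
  by (simp add: corner_def axis_sign_flip)

text \<open>It is 1 iff the corners on the axes X, Y, Z are counterclockwise seen from
  outside.\<close>

definition face_sign :: "nat \<Rightarrow> real" where "face_sign f = axis_sign f X * axis_sign f Y * axis_sign f Z"

lemma face_sign_flip: "f \<in> faces \<Longrightarrow> face_sign (flip f k) = - face_sign f"
  by (cases k) (simp_all add: face_sign_def axis_sign_flip)

lemma face_sign_cases: "face_sign f = 1 \<or> face_sign f = -1"
  by (auto simp: face_sign_def axis_sign_def)

text \<open>Turns the orientation clause of \<open>layout\<close> into an area form in barycentric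
  coordinates, in which the face enters only through its sign.\<close>

lemma triple_bary:
  assumes f: "f \<in> faces" and xyz: "x \<in> face f" "y \<in> face f" "z \<in> face f"
  shows "cross3 (y - x) (z - x) \<bullet> centroid f = face_sign f / (2 * sqrt 2) *
    ((bary f y Y - bary f x Y) * (bary f z Z - bary f x Z) -
     (bary f y Z - bary f x Z) * (bary f z Y - bary f x Y))"
proof -
  have co: "p $ idx k = axis_sign f k * bary f p k / sqrt 2" for p k
    by (simp add: bary_def)
  define d e where "d k = bary f y k - bary f x k" and "e k = bary f z k - bary f x k" for k
  have dX: "d X = - d Y - d Z" and eX: "e X = - e Y - e Z"
    using xyz by (simp_all add: face_iff[OF f] sum_ax d_def e_def)
  have diff: "(y - x) $ idx k = axis_sign f k * d k / sqrt 2" "(z - x) $ idx k = axis_sign f k * e k / sqrt 2" for k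
    unfolding vector_minus_component unfolding co by (simp_all add: d_def e_def field_simps)
  have "cross3 (y - x) (z - x) \<bullet> centroid f =
     ((y - x) $ idx Y * (z - x) $ idx Z - (y - x) $ idx Z * (z - x) $ idx Y) * centroid f $ idx X +
     ((y - x) $ idx Z * (z - x) $ idx X - (y - x) $ idx X * (z - x) $ idx Z) * centroid f $ idx Y +
     ((y - x) $ idx X * (z - x) $ idx Y - (y - x) $ idx Y * (z - x) $ idx X) * centroid f $ idx Z"
    by (simp add: cross3_def inner_vec_def sum_3 idx.simps)
  also have "\<dots> = face_sign f / (2 * (3 * sqrt 2)) * ((d Y * e Z - d Z * e Y) + (d Z * e X - d X * e Z) + (d X * e Y - d Y * e X))"
    unfolding diff centroid_nth[OF f] face_sign_def by (simp add: field_simps)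
  \<comment> \<open>The coordinate differences sum to zero, so the three minors coincide.\<close>
  also have "\<dots> = face_sign f / (2 * sqrt 2) * (d Y * e Z - d Z * e Y)"
    unfolding dX eX by (simp add: field_simps)
  finally show ?thesis by (simp add: d_def e_def)
qed

lemma Im_cnj_cyclic:
  "Im (cnj (b - a) * (c - a)) = Im (cnj (c - b) * (a - b))"
  by (simp add: algebra_simps)

text \<open>Two equilateral triangles on opposite sides of a common edge form a rhombus, so the
  point reflection in the midpoint of the edge exchanges their apexes.\<close>

lemma rhombus_fourth_point:
  assumes "dist p u = 1" "dist p v = 1" "dist p' u = 1" "dist p' v = 1" "dist u v = 1"
    and or: "Im (cnj (u - p) * (v - p)) * Im (cnj (u - p') * (v - p')) < 0"
  shows "p' = u + v - (p :: complex)"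
proof -
  define d where "d = v - u"
  have d: "cmod d = 1" using assms by (simp add: d_def dist_norm norm_minus_commute)
  then have dd: "d * cnj d = 1" by (simp add: complex_norm_square[symmetric])
  \<comment> \<open>After moving \<open>u\<close> to 0, multiplication by \<open>cnj d\<close> turns
    the edge into the segment from 0 to 1. An apex then has real part 1/2 and a height whose square
    is 3/4 and whose sign is the orientation.\<close>
  have half: "Re ((q - u) * cnj d) = 1 / 2 \<and> (Im ((q - u) * cnj d))\<^sup>2 = 3 / 4 \<and>
      Im ((q - u) * cnj d) = Im (cnj (u - q) * (v - q))"
    if "dist q u = 1" "dist q v = 1" for q
  proof -
    let ?a = "(q - u) * cnj d"
    have 1: "(cmod ?a)\<^sup>2 = 1" using that d by (simp add: norm_mult dist_norm)
    have "?a - 1 = (q - v) * cnj d"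
      by (subst dd[symmetric]) (simp add: d_def algebra_simps)
    then have 2: "(cmod (?a - 1))\<^sup>2 = 1" using that d by (simp add: norm_mult dist_norm)
    have "(cmod (?a - 1))\<^sup>2 = (cmod ?a)\<^sup>2 - 2 * Re ?a + 1"
      unfolding cmod_power2 by (simp add: power2_eq_square algebra_simps)
    with 1 2 have re: "Re ?a = 1 / 2" by linarith
    have "(Re ?a)\<^sup>2 + (Im ?a)\<^sup>2 = 1" using 1 by (simp only: cmod_power2)
    then have "(Im ?a)\<^sup>2 = 3 / 4" unfolding re by (simp add: power_divide)
    moreover have "Im ?a = Im (cnj (u - q) * (v - q))"
      by (simp add: d_def algebra_simps)
    ultimately show ?thesis using re by simp
  qed
  let ?a = "(p - u) * cnj d" and ?b = "(p' - u) * cnj d"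
  have im: "Im ?a * Im ?b < 0" using or half[of p] half[of p'] assms by simp
  have "(Im ?a - Im ?b) * (Im ?a + Im ?b) = 0"
    using half[of p] half[of p'] assms by (simp add: power2_eq_square algebra_simps)
  moreover have "Im ?a \<noteq> Im ?b" using im by (metis not_square_less_zero)
  ultimately have "Im ?a + Im ?b = 0" by (metis eq_iff_diff_eq_0 mult_eq_0_iff)
  moreover have "Re ?a + Re ?b = 1" using half[of p] half[of p'] assms by simp
  ultimately have "?a + ?b = 1" by (simp add: complex_eq_iff)
  then have "(?a + ?b) * d = d" by simp
  moreover have "(?a + ?b) * d = (p - u + (p' - u)) * (d * cnj d)"
    by (simp add: algebra_simps)
  ultimately have "p - u + (p' - u) = d" unfolding dd by simp
  then show ?thesis by (simp add: d_def algebra_simps)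
qed

lemma layout_isometry:
  "layout Fs E \<phi> \<Longrightarrow> f \<in> Fs \<Longrightarrow> x \<in> face f \<Longrightarrow> y \<in> face f \<Longrightarrow> dist (\<phi> f x) (\<phi> f y) = dist x y"
  unfolding layout_def by blast

text \<open>If the sign is -1, the triple becomes counterclockwise after exchanging Y and Z, which
  negates the imaginary part.\<close>

lemma layout_orientation:
  assumes \<phi>: "layout Fs E \<phi>" "f \<in> Fs" "f \<in> faces"
  shows "0 < face_sign f * Im (cnj (\<phi> f (corner f Y) - \<phi> f (corner f X)) * (\<phi> f (corner f Z) - \<phi> f (corner f X)))"
proof -
  have or: "Im (cnj (\<phi> f y - \<phi> f x) * (\<phi> f z - \<phi> f x)) > 0"
    if "x \<in> face f" "y \<in> face f" "z \<in> face f" "cross3 (y - x) (z - x) \<bullet> centroid f > 0" for x y z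
    using \<phi> that unfolding layout_def by blast
  consider "face_sign f = 1" | "face_sign f = -1" using face_sign_cases by blast
  then show ?thesis
  proof cases
    case 1
    then show ?thesis
      using or[of "corner f X" "corner f Y" "corner f Z"] \<phi> by (simp add: triple_bary)
  next
    case 2
    then have "0 < Im (cnj (\<phi> f (corner f Z) - \<phi> f (corner f X)) * (\<phi> f (corner f Y) - \<phi> f (corner f X)))"
      using or[of "corner f X" "corner f Z" "corner f Y"] \<phi> by (simp add: triple_bary)
    with 2 show ?thesis by (simp add: algebra_simps)
  qed
qed

lemma layout_bary:
  assumes \<phi>: "layout Fs E \<phi>" "f \<in> Fs" "f \<in> faces" and x: "x \<in> face f"
  shows "\<phi> f x = (\<Sum>k\<in>UNIV. bary f x k *\<^sub>R \<phi> f (corner f k))"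
proof -
  have e: "x = bary f x X *\<^sub>R corner f X + bary f x Y *\<^sub>R corner f Y + bary f x Z *\<^sub>R corner f Z"
    using bary_expand[of x f] unfolding sum_ax .
  have s: "bary f x X + bary f x Y + bary f x Z = 1"
    using x face_iff[OF \<phi>(3)] unfolding sum_ax by blast
  have "\<phi> f (bary f x X *\<^sub>R corner f X + bary f x Y *\<^sub>R corner f Y + bary f x Z *\<^sub>R corner f Z) =
    bary f x X *\<^sub>R \<phi> f (corner f X) + bary f x Y *\<^sub>R \<phi> f (corner f Y) + bary f x Z *\<^sub>R \<phi> f (corner f Z)"
    by (rule isometry_bary3[where S = "face f"])
       (use \<phi> s x layout_isometry[OF \<phi>(1,2)] e[symmetric] in auto)
  then show ?thesis unfolding sum_ax e[symmetric] .
qed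

section \<open>Unfolding a layout along a word\<close>

definition frame :: "(nat \<Rightarrow> real ^ 3 \<Rightarrow> complex) \<Rightarrow> nat \<Rightarrow> complex \<times> complex \<times> complex" where
  "frame \<phi> f = (\<phi> f (corner f X), \<phi> f (corner f Y), \<phi> f (corner f Z))"

lemma proj_frame [simp]: "proj k (frame \<phi> f) = \<phi> f (corner f k)"
  by (cases k) (simp_all add: frame_def)

lemma proj_step: "proj j (step k t) = (if j = k then proj X t + proj Y t + proj Z t - proj k t - proj k t else proj j t)"
  by (cases t; cases j; cases k; simp)

text \<open>The corners on the glued edge stay in place. Since \<open>face_sign\<close> changes
  while exterior sides stay up, the third corner lands on the other side of that edge, at the fourth
  point of the rhombus.\<close>

lemma frame_flip:
  assumes \<phi>: "layout Fs E \<phi>" and f: "f \<in> faces" "f \<in> Fs" "flip f k \<in> Fs" "{f, flip f k} \<in> E"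
  shows "frame \<phi> (flip f k) = step k (frame \<phi> f)"
proof -
  let ?g = "flip f k"
  have g: "?g \<in> faces" using f by simp
  have same: "\<phi> ?g (corner ?g j) = \<phi> f (corner f j)" if "j \<noteq> k" for j
  proof -
    have "corner f j \<in> face f \<inter> face ?g"
      using corner_in_face[OF f(1), of j] corner_in_face[OF g, of j] corner_flip[OF f(1) that] by simp
    then have "\<phi> f (corner f j) = \<phi> ?g (corner f j)"
      using \<phi> f(4) unfolding layout_def by blast
    then show ?thesis by (simp add: corner_flip[OF f(1) that])
  qed
  have d: "dist (\<phi> h (corner h i)) (\<phi> h (corner h j)) = 1" if "h \<in> {f, ?g}" "i \<noteq> j" for h i j
    using that layout_isometry[OF \<phi>] f g by (auto simp: dist_corner)
  have or: "Im (cnj (\<phi> f (corner f Y) - \<phi> f (corner f X)) * (\<phi> f (corner f Z) - \<phi> f (corner f X))) *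
    Im (cnj (\<phi> ?g (corner ?g Y) - \<phi> ?g (corner ?g X)) * (\<phi> ?g (corner ?g Z) - \<phi> ?g (corner ?g X))) < 0"
    (is "?a * ?b < 0")
  proof -
    have "0 < face_sign f * ?a" "0 < - face_sign f * ?b"
      using layout_orientation[OF \<phi> f(2,1)] layout_orientation[OF \<phi> f(3) g]
      unfolding face_sign_flip[OF f(1)] by this+
    then show ?thesis using face_sign_cases[of f] by (auto simp: mult_less_0_iff)
  qed
  have opp: "\<phi> ?g (corner ?g k) = \<phi> f (corner f i) + \<phi> f (corner f j) - \<phi> f (corner f k)"
    if "(k, i, j) \<in> {(X, Y, Z), (Y, Z, X), (Z, X, Y)}" for i j
  proof (rule rhombus_fourth_point)
    have ne: "k \<noteq> i" "k \<noteq> j" "i \<noteq> j" using that by auto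
    show "dist (\<phi> f (corner f k)) (\<phi> f (corner f i)) = 1" "dist (\<phi> f (corner f k)) (\<phi> f (corner f j)) = 1"
      "dist (\<phi> f (corner f i)) (\<phi> f (corner f j)) = 1"
      "dist (\<phi> ?g (corner ?g k)) (\<phi> f (corner f i)) = 1" "dist (\<phi> ?g (corner ?g k)) (\<phi> f (corner f j)) = 1"
      using d[of f] d[of ?g k i] d[of ?g k j] ne same[of i] same[of j] by auto
    show "Im (cnj (\<phi> f (corner f i) - \<phi> f (corner f k)) * (\<phi> f (corner f j) - \<phi> f (corner f k))) *
      Im (cnj (\<phi> f (corner f i) - \<phi> ?g (corner ?g k)) * (\<phi> f (corner f j) - \<phi> ?g (corner ?g k))) < 0"
    proof -
      have rot: "Im (cnj (\<phi> h (corner h i) - \<phi> h (corner h k)) * (\<phi> h (corner h j) - \<phi> h (corner h k))) =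
        Im (cnj (\<phi> h (corner h Y) - \<phi> h (corner h X)) * (\<phi> h (corner h Z) - \<phi> h (corner h X)))" for h
        using that Im_cnj_cyclic by auto
      show ?thesis using or rot[of f] rot[of ?g] same[of i] same[of j] ne by simp
    qed
  qed
  show ?thesis
  proof (cases k)
    case X
    then show ?thesis using opp[of Y Z] same[of Y] same[of Z] by (simp add: frame_def)
  next
    case Y
    then show ?thesis using opp[of Z X] same[of X] same[of Z] by (simp add: frame_def add.commute)
  next
    case Z
    then show ?thesis using opp[of X Y] same[of Y] same[of X] by (simp add: frame_def)
  qed
qed

lemma path_edges_walk:
  "path_edges (walk f []) = {}"
  "path_edges (walk f (k # w)) = insert {f, flip f k} (path_edges (walk (flip f k) w))"
  by (cases w; simp add: path_edges_def)+

lemma frame_endpoint: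
  assumes \<phi>: "layout Fs E \<phi>" and "f \<in> faces" "set (walk f w) \<subseteq> Fs" "path_edges (walk f w) \<subseteq> E"
  shows "frame \<phi> (endpoint f w) = fold step w (frame \<phi> f)"
  using assms(2-)
proof (induction w arbitrary: f)
  case (Cons k w)
  have "flip f k \<in> set (walk (flip f k) w)" by (cases w) auto
  moreover have "{f, flip f k} \<in> E" "path_edges (walk (flip f k) w) \<subseteq> E"
    using Cons.prems(3) unfolding path_edges_walk by auto
  ultimately show ?case
    using Cons.prems frame_flip[OF \<phi>, of f k] Cons.IH[of "flip f k"] by auto
qed simp

text \<open>Each \<open>step\<close> forms an integer combination of the corners with coefficients
  summing to 1, so it commutes with the affine map from lattice coordinates.\<close>

lemma proj_fold_step:
  fixes z u v :: "'a::comm_ring_1"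
  assumes "\<And>k. proj k t = z + of_int (proj k a) * u + of_int (proj k b) * v"
  shows "proj k (fold step w t) = z + of_int (proj k (fold step w a)) * u + of_int (proj k (fold step w b)) * v"
  using assms
proof (induction w arbitrary: t a b)
  case (Cons j w)
  have "proj k (step j t) = z + of_int (proj k (step j a)) * u + of_int (proj k (step j b)) * v" for k
    by (cases k; cases j) (simp_all add: proj_step Cons.prems algebra_simps)
  then show ?case using Cons.IH by simp
qed simp

text \<open>The three unit lengths force the inner product of \<open>u\<close> and \<open>v\<close>
  to be 1/2, which gives the mixed term.\<close>

lemma norm_sq_lattice:
  fixes u v :: complex
  assumes "dist 0 u = 1" "dist 0 v = 1" "dist u v = 1"
  shows "(norm (of_int a * u + of_int b * v))\<^sup>2 = of_int (a * a + a * b + b * b)"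
proof -
  have 1: "(norm u)\<^sup>2 = 1" "(norm v)\<^sup>2 = 1" "(norm (u - v))\<^sup>2 = 1"
    using assms by (simp_all add: dist_norm)
  show ?thesis
    using 1 unfolding cmod_power2
    by simp (simp add: power2_eq_square, algebra)
qed

lemma layout_dist_corners:
  assumes \<phi>: "layout Fs E \<phi>" and f: "f \<in> faces" "set (walk f w) \<subseteq> Fs" "path_edges (walk f w) \<subseteq> E"
  shows "(dist (\<phi> f (corner f i)) (\<phi> (endpoint f w) (corner (endpoint f w) j)))\<^sup>2 = of_int (corner_sqdist w i j)"
proof -
  define z u v where "z = \<phi> f (corner f X)" "u = \<phi> f (corner f Y) - z" "v = \<phi> f (corner f Z) - z"
  note zuv = this
  have fF: "f \<in> Fs" using f(2) by (cases w) auto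
  have "dist (\<phi> f (corner f i)) (\<phi> f (corner f j)) = 1" if "i \<noteq> j" for i j
    using that layout_isometry[OF \<phi> fF] f by (auto simp: dist_corner)
  from this[of X Y] this[of X Z] this[of Y Z] have d: "dist 0 u = 1" "dist 0 v = 1" "dist u v = 1"
    unfolding zuv by (simp_all add: dist_norm norm_minus_commute)
  have base: "proj k (frame \<phi> f) = z + of_int (proj k lattice_x) * u + of_int (proj k lattice_y) * v" for k
    by (cases k) (simp_all add: lattice_x_def lattice_y_def zuv)
  have "\<phi> (endpoint f w) (corner (endpoint f w) j) = proj j (fold step w (frame \<phi> f))"
    using frame_endpoint[OF \<phi> f] by (metis proj_frame)
  also have "\<dots> = z + of_int (proj j (fold step w lattice_x)) * u + of_int (proj j (fold step w lattice_y)) * v"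
    by (rule proj_fold_step) (rule base)
  finally have "\<phi> f (corner f i) - \<phi> (endpoint f w) (corner (endpoint f w) j) =
      of_int (proj i lattice_x - proj j (fold step w lattice_x)) * u + of_int (proj i lattice_y - proj j (fold step w lattice_y)) * v"
    using base[of i] by (simp add: algebra_simps)
  then show ?thesis
    by (simp only: dist_norm norm_sq_lattice[OF d] corner_sqdist_def Let_def)
qed

text \<open>The correction term of Leibniz's formula for a triangle with unit sides.\<close>

definition spread :: "(axis3 \<Rightarrow> real) \<Rightarrow> real" where
  "spread l = l X * l Y + l Y * l Z + l Z * l X"

text \<open>Bilinear apart from the \<open>spread\<close> terms, which do not depend on the word and
  cancel when two words are compared.\<close>

definition sqdist_bary :: "axis3 list \<Rightarrow> (axis3 \<Rightarrow> real) \<Rightarrow> (axis3 \<Rightarrow> real) \<Rightarrow> real" where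
  "sqdist_bary w l m = (\<Sum>i\<in>UNIV. \<Sum>j\<in>UNIV. l i * m j * of_int (corner_sqdist w i j)) - spread l - spread m"

text \<open>Leibniz's formula is applied to \<open>q\<close> in the last face and then, for each
  corner of that face, to \<open>p\<close> in the first one.\<close>

lemma layout_dist_sq:
  assumes \<phi>: "layout Fs E \<phi>" and f: "f \<in> faces" "set (walk f w) \<subseteq> Fs" "path_edges (walk f w) \<subseteq> E"
    and p: "p \<in> face f" and q: "q \<in> face (endpoint f w)"
  shows "(dist (\<phi> f p) (\<phi> (endpoint f w) q))\<^sup>2 = sqdist_bary w (bary f p) (bary (endpoint f w) q)"
proof -
  let ?g = "endpoint f w"
  have g: "?g \<in> faces" using f by simp
  have fF: "f \<in> Fs" "?g \<in> Fs" using f(2) last_walk[of f w] hd_walk[of f w]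
    by (metis last_in_set hd_in_set subsetD walk_not_Nil)+
  have tri: "(dist z (\<phi> h x))\<^sup>2 = (\<Sum>k\<in>UNIV. bary h x k * (dist z (\<phi> h (corner h k)))\<^sup>2) - spread (bary h x)"
    if "h \<in> Fs" "h \<in> faces" "x \<in> face h" for h x z
  proof -
    have s: "bary h x X + bary h x Y + bary h x Z = 1"
      using that face_iff unfolding sum_ax by blast
    have d: "dist (\<phi> h (corner h i)) (\<phi> h (corner h j)) = 1" if "i \<noteq> j" for i j
      using that layout_isometry[OF \<phi> \<open>h \<in> Fs\<close>] \<open>h \<in> faces\<close> by (auto simp: dist_corner)
    show ?thesis
      unfolding layout_bary[OF \<phi> that] sum_ax dist_sq_bary3[OF s] spread_def
      by (simp add: d)
  qed
  have inner: "(dist (\<phi> f p) (\<phi> ?g (corner ?g j)))\<^sup>2 =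
      (\<Sum>i\<in>UNIV. bary f p i * of_int (corner_sqdist w i j)) - spread (bary f p)" for j
    unfolding dist_commute[of "\<phi> f p"] tri[OF fF(1) f(1) p]
    unfolding dist_commute[of "\<phi> ?g (corner ?g j)"] layout_dist_corners[OF \<phi> f] ..
  have "(dist (\<phi> f p) (\<phi> ?g q))\<^sup>2 =
      (\<Sum>j\<in>UNIV. bary ?g q j * (dist (\<phi> f p) (\<phi> ?g (corner ?g j)))\<^sup>2) - spread (bary ?g q)"
    by (rule tri[OF fF(2) g q])
  also have "\<dots> = (\<Sum>j\<in>UNIV. bary ?g q j * ((\<Sum>i\<in>UNIV. bary f p i * of_int (corner_sqdist w i j)) - spread (bary f p)))
      - spread (bary ?g q)"
    unfolding inner ..
  also have "\<dots> = (\<Sum>j\<in>UNIV. \<Sum>i\<in>UNIV. bary f p i * bary ?g q j * of_int (corner_sqdist w i j))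
      - (\<Sum>j\<in>UNIV. bary ?g q j) * spread (bary f p) - spread (bary ?g q)"
    by (simp add: right_diff_distrib sum_subtractf sum_distrib_left sum_distrib_right mult_ac)
  also have "(\<Sum>j\<in>UNIV. bary ?g q j) = 1" using q face_iff[OF g] by blast
  finally show ?thesis unfolding sqdist_bary_def by (subst sum.swap) simp
qed

section \<open>Nets\<close>

fun separated :: "int \<times> int \<times> int \<Rightarrow> int \<times> int \<times> int \<Rightarrow> bool" where
  "separated (p, q, r) (p', q', r') \<longleftrightarrow> max p (max q r) \<le> min p' (min q' r')"

text \<open>
  The net is a strip of six triangles, with the two remaining ones glued to opposite sides of it.
\<close>

definition tree :: "axis3 \<Rightarrow> axis3 \<Rightarrow> axis3 \<Rightarrow> axis3 list list" where
  "tree a b c = [[], [a], [a,b], [a,b,c], [a,b,c,a], [a,b,c,a,b], [b], [a,c]]"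

text \<open>A word with a letter encodes the edge between the faces reached before and after that
  letter.\<close>

definition tree_steps :: "axis3 \<Rightarrow> axis3 \<Rightarrow> axis3 \<Rightarrow> (axis3 list \<times> axis3) set" where
  "tree_steps a b c = {([], a), ([a], b), ([a,b], c), ([a,b,c], a), ([a,b,c,a], b), ([], b), ([a], c)}"

definition strip_net :: "nat \<Rightarrow> axis3 \<Rightarrow> axis3 \<Rightarrow> axis3 \<Rightarrow> nat set set" where
  "strip_net f a b c = (\<lambda>(v, k). {endpoint f v, endpoint f (v @ [k])}) ` tree_steps a b c"

text \<open>
  The three coordinates are \<open>x\<close>, \<open>y\<close> and \<open>x + y\<close>; distinct lattice triangles are separated by a
  lattice line in one of these directions.
\<close>

definition non_overlapping :: "axis3 list \<Rightarrow> axis3 list \<Rightarrow> bool" where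
  "non_overlapping v w \<longleftrightarrow> v = w \<or>
    list_ex (\<lambda>t. separated (fold step v t) (fold step w t) \<or> separated (fold step w t) (fold step v t)) [lattice_x, lattice_y, (0, 1, 1)]"

definition axis_perms :: "axis3 list list" where
  "axis_perms = [[X,Y,Z], [X,Z,Y], [Y,X,Z], [Y,Z,X], [Z,X,Y], [Z,Y,X]]"

lemma distinct_perms: "distinct [a, b, c] \<Longrightarrow> [a, b, c] \<in> set axis_perms"
  by (cases a; cases b; cases c; simp add: axis_perms_def)

text \<open>The placement depends on the words only, so six orders of the axes remain to be
  evaluated; distinctness is checked from face 1 and carries over by symmetry.\<close>

lemma tree_check:
  "list_all (\<lambda>s. let t = tree (s!0) (s!1) (s!2) in
     distinct (map (endpoint 1) t) \<and> list_all (\<lambda>v. list_all (non_overlapping v) t) t) axis_perms"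
  by code_simp

lemma tree_disj:
  assumes "distinct [a, b, c]" "v \<in> set (tree a b c)" "w \<in> set (tree a b c)"
  shows "non_overlapping v w"
  using tree_check distinct_perms[OF assms(1)] assms(2,3)
  by (fastforce simp: list_all_iff Let_def)

lemma inj_endpoint_tree:
  assumes "distinct [a, b, c]" and f: "f \<in> faces"
  shows "inj_on (endpoint f) (set (tree a b c))"
proof -
  have "distinct (map (endpoint 1) (tree a b c))"
    using tree_check distinct_perms[OF assms(1)] by (fastforce simp: list_all_iff Let_def)
  then show ?thesis
    by (auto simp: distinct_map inj_on_def endpoint_eq_1[OF f])
qed

lemma endpoint_tree:
  assumes "distinct [a, b, c]" and f: "f \<in> faces"
  shows "endpoint f ` set (tree a b c) = faces"
proof (rule card_subset_eq)
  have "distinct (tree a b c)" using assms(1) by (auto simp: tree_def)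
  then have "card (set (tree a b c)) = 8"
    by (subst distinct_card) (simp_all add: tree_def)
  then show "card (endpoint f ` set (tree a b c)) = card faces"
    using card_image[OF inj_endpoint_tree[OF assms]] by (simp add: faces_def)
qed (use f in \<open>auto simp: faces_eq[symmetric] faces_def[symmetric]\<close>, simp add: faces_def)

lemma tree_steps_in:
  "(v, k) \<in> tree_steps a b c \<Longrightarrow> v \<in> set (tree a b c) \<and> v @ [k] \<in> set (tree a b c)"
  by (auto simp: tree_steps_def tree_def)

text \<open>The edges are counted as pairs of words, and injectivity of \<open>endpoint f\<close> on
  the tree transfers the count to faces.\<close>

lemma card_strip_net:
  assumes d: "distinct [a, b, c]" and f: "f \<in> faces"
  shows "card (strip_net f a b c) = 7"
proof -
  let ?W = "(\<lambda>(v, k). {v, v @ [k]}) ` tree_steps a b c"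
  have "strip_net f a b c = image (endpoint f) ` ?W"
    unfolding strip_net_def image_image by (rule image_cong) auto
  moreover have "inj_on (image (endpoint f)) ?W"
    by (rule inj_on_image, rule inj_on_subset[OF inj_endpoint_tree[OF assms]])
       (auto dest: tree_steps_in)
  moreover have "card ?W = 7"
    using d by (auto simp: tree_steps_def doubleton_eq_iff)
  ultimately show ?thesis by (simp add: card_image)
qed

lemma connected_strip_net:
  assumes d: "distinct [a, b, c]" and f: "f \<in> faces" and "g \<in> faces" "h \<in> faces"
  shows "(g, h) \<in> {(x, y). {x, y} \<in> strip_net f a b c}\<^sup>*"
proof -
  let ?R = "{(x, y). {x, y} \<in> strip_net f a b c}"
  have sym: "sym (?R\<^sup>*)"
    by (rule sym_rtrancl) (auto simp: sym_def insert_commute)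
  have step: "(f, endpoint f (v @ [k])) \<in> ?R\<^sup>*"
    if "(f, endpoint f v) \<in> ?R\<^sup>*" "(v, k) \<in> tree_steps a b c" for v k
    by (rule rtrancl_into_rtrancl[OF that(1)]) (use that(2) in \<open>force simp: strip_net_def\<close>)
  have r0: "(f, endpoint f []) \<in> ?R\<^sup>*" by simp
  have ra: "(f, endpoint f [a]) \<in> ?R\<^sup>*" using step[OF r0, of a] by (simp add: tree_steps_def)
  have rb: "(f, endpoint f [b]) \<in> ?R\<^sup>*" using step[OF r0, of b] by (simp add: tree_steps_def)
  have rac: "(f, endpoint f [a,c]) \<in> ?R\<^sup>*" using step[OF ra, of c] by (simp add: tree_steps_def)
  have rab: "(f, endpoint f [a,b]) \<in> ?R\<^sup>*" using step[OF ra, of b] by (simp add: tree_steps_def)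
  have rabc: "(f, endpoint f [a,b,c]) \<in> ?R\<^sup>*" using step[OF rab, of c] by (simp add: tree_steps_def)
  have rabca: "(f, endpoint f [a,b,c,a]) \<in> ?R\<^sup>*" using step[OF rabc, of a] by (simp add: tree_steps_def)
  have rabcab: "(f, endpoint f [a,b,c,a,b]) \<in> ?R\<^sup>*" using step[OF rabca, of b] by (simp add: tree_steps_def)
  have "(f, x) \<in> ?R\<^sup>*" if x: "x \<in> faces" for x
  proof -
    obtain v where "v \<in> set (tree a b c)" "x = endpoint f v"
      using x endpoint_tree[OF d f] by (metis imageE)
    then show ?thesis
      using r0 ra rb rac rab rabc rabca rabcab unfolding tree_def by auto
  qed
  then show ?thesis using assms(3,4) sym by (meson rtrancl_trans symD)
qed

section \<open>Affine images of the faces in the plane\<close>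

fun equilateral :: "complex \<times> complex \<times> complex \<Rightarrow> bool" where
  "equilateral (p, q, r) \<longleftrightarrow> dist p q = 1 \<and> dist q r = 1 \<and> dist r p = 1"

text \<open>Twice the signed area, positive for counterclockwise triples.\<close>

fun orient :: "complex \<times> complex \<times> complex \<Rightarrow> real" where
  "orient (p, q, r) = Im (cnj (q - p) * (r - p))"

lemma equilateral_step: "equilateral t \<Longrightarrow> equilateral (step k t)"
  by (cases t; cases k) (auto simp: dist_norm norm_minus_commute)

lemma equilateral_fold: "equilateral t \<Longrightarrow> equilateral (fold step w t)"
  by (induction w arbitrary: t) (simp_all add: equilateral_step)

lemma orient_step: "orient (step k t) = - orient t"
  by (cases t; cases k) (simp_all add: algebra_simps)

lemma orient_fold:
  "f \<in> faces \<Longrightarrow> orient t = r * face_sign f \<Longrightarrow> orient (fold step w t) = r * face_sign (endpoint f w)"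
  by (induction w arbitrary: f t) (simp_all add: orient_step face_sign_flip)

lemma dist_bary3_eq:
  fixes A B C :: "'a::real_inner" and A' B' C' :: "'b::real_inner"
  assumes "a + b + c = 1" "a' + b' + c' = 1"
    and "dist A B = dist A' B'" "dist B C = dist B' C'" "dist C A = dist C' A'"
  shows "dist (a *\<^sub>R A + b *\<^sub>R B + c *\<^sub>R C) (a' *\<^sub>R A + b' *\<^sub>R B + c' *\<^sub>R C) =
    dist (a *\<^sub>R A' + b *\<^sub>R B' + c *\<^sub>R C') (a' *\<^sub>R A' + b' *\<^sub>R B' + c' *\<^sub>R C')"
proof -
  have eq: "dist D (a *\<^sub>R A + b *\<^sub>R B + c *\<^sub>R C) = dist D' (a *\<^sub>R A' + b *\<^sub>R B' + c *\<^sub>R C')"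
    if "dist D A = dist D' A'" "dist D B = dist D' B'" "dist D C = dist D' C'" for D D'
  proof -
    have "(dist D (a *\<^sub>R A + b *\<^sub>R B + c *\<^sub>R C))\<^sup>2 = (dist D' (a *\<^sub>R A' + b *\<^sub>R B' + c *\<^sub>R C'))\<^sup>2"
      unfolding dist_sq_bary3[OF assms(1)] that assms ..
    then show ?thesis by simp
  qed
  have "(dist (a *\<^sub>R A + b *\<^sub>R B + c *\<^sub>R C) (a' *\<^sub>R A + b' *\<^sub>R B + c' *\<^sub>R C))\<^sup>2 =
    (dist (a *\<^sub>R A' + b *\<^sub>R B' + c *\<^sub>R C') (a' *\<^sub>R A' + b' *\<^sub>R B' + c' *\<^sub>R C'))\<^sup>2"
    unfolding dist_sq_bary3[OF assms(2)] assms
    using eq[of A A'] eq[of B B'] eq[of C C'] assms(3-) by (simp add: dist_commute)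
  then show ?thesis by simp
qed

text \<open>The affine map of the face onto the triangle \<open>t\<close> that respects the axes of
  the corners.\<close>

definition tri :: "complex \<times> complex \<times> complex \<Rightarrow> nat \<Rightarrow> real ^ 3 \<Rightarrow> complex" where
  "tri t g x = (\<Sum>k\<in>UNIV. bary g x k *\<^sub>R proj k t)"

lemma tri_isometry:
  assumes "equilateral t" "g \<in> faces" "x \<in> face g" "y \<in> face g"
  shows "dist (tri t g x) (tri t g y) = dist x y"
proof -
  obtain p q r where t: "t = (p, q, r)" by (cases t)
  have e: "x = bary g x X *\<^sub>R corner g X + bary g x Y *\<^sub>R corner g Y + bary g x Z *\<^sub>R corner g Z" for x
    using bary_expand[of x g] unfolding sum_ax .
  have s: "bary g x X + bary g x Y + bary g x Z = 1" "bary g y X + bary g y Y + bary g y Z = 1"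
    using assms face_iff unfolding sum_ax by blast+
  have "dist (tri t g x) (tri t g y) = dist
     (bary g x X *\<^sub>R corner g X + bary g x Y *\<^sub>R corner g Y + bary g x Z *\<^sub>R corner g Z)
     (bary g y X *\<^sub>R corner g X + bary g y Y *\<^sub>R corner g Y + bary g y Z *\<^sub>R corner g Z)"
    unfolding tri_def sum_ax t proj.simps
    by (rule dist_bary3_eq[OF s]) (use assms t in \<open>simp_all add: dist_corner\<close>)
  then show ?thesis unfolding e[symmetric] .
qed

lemma tri_orientation:
  assumes "0 < face_sign g * orient t" "g \<in> faces" "x \<in> face g" "y \<in> face g" "z \<in> face g"
    and pos: "cross3 (y - x) (z - x) \<bullet> centroid g > 0"
  shows "Im (cnj (tri t g y - tri t g x) * (tri t g z - tri t g x)) > 0"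
proof -
  obtain p q r where t: "t = (p, q, r)" by (cases t)
  define d e where "d k = bary g y k - bary g x k" and "e k = bary g z k - bary g x k" for k
  have dX: "d X = - d Y - d Z" and eX: "e X = - e Y - e Z"
    using assms(3-5) by (simp_all add: face_iff[OF assms(2)] sum_ax d_def e_def)
  have 1: "tri t g y - tri t g x = d X *\<^sub>R p + d Y *\<^sub>R q + d Z *\<^sub>R r"
    by (simp add: tri_def sum_ax t d_def algebra_simps)
  have 2: "tri t g z - tri t g x = e X *\<^sub>R p + e Y *\<^sub>R q + e Z *\<^sub>R r"
    by (simp add: tri_def sum_ax t e_def algebra_simps)
  have "Im (cnj (tri t g y - tri t g x) * (tri t g z - tri t g x)) = (d Y * e Z - d Z * e Y) * orient t"
    unfolding 1 2 unfolding dX eX t by (simp add: algebra_simps)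
  moreover have "0 < face_sign g * (d Y * e Z - d Z * e Y)"
    using pos unfolding triple_bary[OF assms(2-5)] by (simp add: d_def e_def zero_less_mult_iff zero_less_divide_iff divide_less_0_iff)
  ultimately show ?thesis
    using assms(1) face_sign_cases[of g] by (auto simp: zero_less_mult_iff)
qed

lemma tri_halfplane:
  assumes "g \<in> faces" "x \<in> face g" "\<And>k. u \<bullet> proj k t \<le> n"
  shows "u \<bullet> tri t g x \<le> n"
proof -
  have b: "\<And>k. 0 \<le> bary g x k" "(\<Sum>k\<in>UNIV. bary g x k) = 1"
    using assms face_iff by blast+
  have "u \<bullet> tri t g x = (\<Sum>k\<in>UNIV. bary g x k * (u \<bullet> proj k t))"
    by (simp add: tri_def inner_sum_right)
  also have "\<dots> \<le> (\<Sum>k\<in>UNIV. bary g x k * n)"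
    by (intro sum_mono mult_left_mono assms b)
  also have "\<dots> = n" using b by (simp add: sum_distrib_right[symmetric])
  finally show ?thesis .
qed

lemma interior_disjoint_halfplanes:
  fixes u :: "'a::euclidean_space"
  assumes "u \<noteq> 0" "\<And>x. x \<in> S \<Longrightarrow> u \<bullet> x \<le> n" "\<And>x. x \<in> T \<Longrightarrow> n \<le> u \<bullet> x"
  shows "interior S \<inter> interior T = {}"
proof -
  have "interior S \<subseteq> {x. u \<bullet> x < n}" "interior T \<subseteq> {x. u \<bullet> x > n}"
    using interior_mono[of S "{x. u \<bullet> x \<le> n}"] interior_mono[of T "{x. u \<bullet> x \<ge> n}"] assms
    by (auto simp: interior_halfspace_le interior_halfspace_ge)
  then show ?thesis by force
qed

lemma sep_witness: "separated s t \<Longrightarrow> \<exists>n. \<forall>k. proj k s \<le> n \<and> n \<le> proj k t"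
  by (cases s; cases t; rule exI[of _ "max (fst s) (max (fst (snd s)) (snd (snd s)))"])
     (auto simp: all_ax)

text \<open>The coordinate on axis \<open>k\<close> changes sign between the two faces and is
  nonnegative in both, so it vanishes, and the corner that was moved has weight zero.\<close>

lemma tri_flip:
  assumes g: "g \<in> faces" and x: "x \<in> face g" "x \<in> face (flip g k)"
  shows "tri (step k t) (flip g k) x = tri t g x"
proof -
  have b: "bary (flip g k) x j = (if j = k then - bary g x j else bary g x j)" for j
    by (simp add: bary_def axis_sign_flip[OF g])
  have "0 \<le> bary g x k" "0 \<le> bary (flip g k) x k"
    using x face_iff g flip_in by blast+
  then have "bary g x k = 0" using b[of k] by simp
  then show ?thesis
    unfolding tri_def by (intro sum.cong) (auto simp: b proj_step)
qed

text \<open>The layout places the face reached by a tree word on the start triangle unfolded along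
  this word.\<close>

lemma net_strip_net:
  assumes d: "distinct [a, b, c]" and f: "f \<in> faces"
  shows "net (strip_net f a b c)"
proof -
  let ?N = "strip_net f a b c" and ?T = "set (tree a b c)"
  \<comment> \<open>The start triangle is 0, 1, \<open>\<omega>\<close>; the sign of the imaginary
    part makes its orientation agree with \<open>face_sign f\<close>, so that exterior sides are
    up.\<close>
  define \<omega> where "\<omega> = Complex (1 / 2) (face_sign f * sqrt 3 / 2)"
  define t where "t v = fold step v (0, 1, \<omega>)" for v
  define \<phi> where "\<phi> g = tri (t (the_inv_into ?T (endpoint f) g)) g" for g
  have \<phi>: "\<phi> (endpoint f v) = tri (t v) (endpoint f v)" if "v \<in> ?T" for v
    using that by (simp add: \<phi>_def the_inv_into_f_f[OF inj_endpoint_tree[OF d f]])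
  have word: "\<exists>v\<in>?T. g = endpoint f v" if "g \<in> faces" for g
    using that endpoint_tree[OF d f] by (metis imageE)
  have s2: "face_sign f * face_sign f = 1" using face_sign_cases[of f] by auto
  have s2': "face_sign f * (face_sign f * x) = x" for x using face_sign_cases[of f] by auto
  have "equilateral (0, 1, \<omega>)"
    by (simp add: \<omega>_def dist_norm cmod_def power2_eq_square s2' field_simps)
  then have eq: "equilateral (t v)" for v unfolding t_def by (rule equilateral_fold)
  have "orient (0, 1, \<omega>) = sqrt 3 / 2 * face_sign f" by (simp add: \<omega>_def)
  then have orv: "orient (t v) = sqrt 3 / 2 * face_sign (endpoint f v)" for v
    unfolding t_def by (rule orient_fold[OF f])
  have or: "0 < face_sign (endpoint f v) * orient (t v)" for v
    unfolding orv using face_sign_cases[of "endpoint f v"] by auto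
  have pt: "proj k (t v) = of_int (proj k (fold step v lattice_x)) + of_int (proj k (fold step v lattice_y)) * \<omega>" for k v
  proof -
    have "proj k (0, 1, \<omega>) = 0 + of_int (proj k lattice_x) * 1 + of_int (proj k lattice_y) * \<omega>" for k
      by (cases k) (simp_all add: lattice_x_def lattice_y_def)
    from proj_fold_step[OF this] show ?thesis by (simp add: t_def)
  qed
  have diag: "proj k (fold step v (0, 1, 1)) = proj k (fold step v lattice_x) + proj k (fold step v lattice_y)" for k v
  proof -
    have "proj k (0, 1, 1) = 0 + of_int (proj k lattice_x) * 1 + of_int (proj k lattice_y) * (1::int)" for k
      by (cases k) (simp_all add: lattice_x_def lattice_y_def)
    from proj_fold_step[OF this] show ?thesis by simp
  qed
  \<comment> \<open>The coordinates x, y and x + y are linear functionals on the plane, so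
    separation by a lattice line yields two half-planes.\<close>
  have coord: "\<exists>u. u \<noteq> 0 \<and> (\<forall>v k. u \<bullet> proj k (t v) = of_int (proj k (fold step v s)))"
    if s: "s \<in> {lattice_x, lattice_y, (0, 1, 1)}" for s
  proof -
    define h where "h = face_sign f * sqrt 3 / 2"
    have h: "h \<noteq> 0" using face_sign_cases[of f] by (auto simp: h_def)
    \<comment> \<open>\<open>u1\<close> and \<open>u2\<close> are the dual basis of 1 and
      \<open>\<omega>\<close>.\<close>
    define u1 where "u1 = Complex 1 (- 1 / (2 * h))"
    define u2 where "u2 = Complex 0 (1 / h)"
    have om: "\<omega> = Complex (1 / 2) h" by (simp add: \<omega>_def h_def)
    have u1: "u1 \<bullet> (of_int m + of_int n * \<omega>) = of_int m" for m n
      using h by (simp add: inner_complex_def u1_def om field_simps)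
    have u2: "u2 \<bullet> (of_int m + of_int n * \<omega>) = of_int n" for m n
      using h by (simp add: inner_complex_def u2_def om field_simps)
    consider "s = lattice_x" | "s = lattice_y" | "s = (0, 1, 1)" using s by blast
    then show ?thesis
    proof cases
      case 1
      then show ?thesis unfolding pt using u1
        by (intro exI[of _ u1]) (simp add: u1_def complex_eq_iff)
    next
      case 2
      then show ?thesis unfolding pt using u2 h
        by (intro exI[of _ u2]) (simp add: u2_def complex_eq_iff)
    next
      case 3
      then show ?thesis unfolding pt using u1 u2
        by (intro exI[of _ "u1 + u2"]) (simp add: diag u1_def u2_def complex_eq_iff inner_add_left)
    qed
  qed
  have disj1: "interior (\<phi> (endpoint f v) ` face (endpoint f v)) \<inter> interior (\<phi> (endpoint f w) ` face (endpoint f w)) = {}"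
    if vw: "v \<in> ?T" "w \<in> ?T" and s: "s \<in> {lattice_x, lattice_y, (0, 1, 1)}" "separated (fold step v s) (fold step w s)" for v w s
  proof -
    obtain u where u: "u \<noteq> 0" "\<And>v k. u \<bullet> proj k (t v) = of_int (proj k (fold step v s))"
      using coord[OF s(1)] by blast
    obtain n where n: "\<And>k. proj k (fold step v s) \<le> n" "\<And>k. n \<le> proj k (fold step w s)"
      using sep_witness[OF s(2)] by blast
    show ?thesis
    proof (rule interior_disjoint_halfplanes[OF u(1), where n = "of_int n"])
      fix z assume "z \<in> \<phi> (endpoint f v) ` face (endpoint f v)"
      then show "u \<bullet> z \<le> of_int n"
        using vw(1) n(1) f by (auto simp: \<phi> u intro!: tri_halfplane)
    next
      fix z assume "z \<in> \<phi> (endpoint f w) ` face (endpoint f w)"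
      then obtain x where x: "x \<in> face (endpoint f w)" "z = tri (t w) (endpoint f w) x"
        using vw(2) by (auto simp: \<phi>)
      have "(- u) \<bullet> tri (t w) (endpoint f w) x \<le> - of_int n"
        by (rule tri_halfplane[OF _ x(1)]) (use f n(2) u in auto)
      with x show "of_int n \<le> u \<bullet> z" by simp
    qed
  qed
  have "layout faces ?N \<phi>"
    unfolding layout_def
  proof (intro conjI ballI allI impI)
    fix g x y assume "g \<in> faces" "x \<in> face g" "y \<in> face g"
    then show "dist (\<phi> g x) (\<phi> g y) = dist x y"
      using word[of g] by (auto simp: \<phi> intro!: tri_isometry eq)
  next
    fix g x y z assume a: "g \<in> faces" "x \<in> face g" "y \<in> face g" "z \<in> face g"
      "0 < cross3 (y - x) (z - x) \<bullet> centroid g"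
    then obtain v where "v \<in> ?T" "g = endpoint f v" using word by blast
    then show "0 < Im (cnj (\<phi> g y - \<phi> g x) * (\<phi> g z - \<phi> g x))"
      using tri_orientation[OF or a(1-4)[unfolded \<open>g = endpoint f v\<close>]] a(5) by (simp add: \<phi>)
  next
    fix g h x assume gh: "{g, h} \<in> ?N" and x: "x \<in> face g \<inter> face h"
    then obtain v k where vk: "(v, k) \<in> tree_steps a b c" "{g, h} = {endpoint f v, endpoint f (v @ [k])}"
      by (auto simp: strip_net_def)
    have "x \<in> face (endpoint f v)" "x \<in> face (flip (endpoint f v) k)"
      using vk(2) x by (auto simp: doubleton_eq_iff)
    then have "\<phi> (endpoint f v) x = \<phi> (endpoint f (v @ [k])) x"
      using tree_steps_in[OF vk(1)] tri_flip[of "endpoint f v" x k "t v"] f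
      by (subst (1 2) \<phi>) (auto simp: t_def)
    then show "\<phi> g x = \<phi> h x" using vk(2) by (auto simp: doubleton_eq_iff)
  next
    fix g h assume gh: "g \<in> faces" "h \<in> faces" "g \<noteq> h"
    then obtain v w where vw: "v \<in> ?T" "w \<in> ?T" "g = endpoint f v" "h = endpoint f w"
      using word by metis
    with gh have "non_overlapping v w" "v \<noteq> w" using tree_disj[OF d] by auto
    then have "\<exists>s\<in>set [lattice_x, lattice_y, (0, 1, 1)].
      separated (fold step v s) (fold step w s) \<or> separated (fold step w s) (fold step v s)"
      unfolding non_overlapping_def list_ex_iff by blast
    then obtain s where "s \<in> {lattice_x, lattice_y, (0, 1, 1)}"
      "separated (fold step v s) (fold step w s) \<or> separated (fold step w s) (fold step v s)"
      unfolding list.set by blast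
    then show "interior (\<phi> g ` face g) \<inter> interior (\<phi> h ` face h) = {}"
      using disj1[OF vw(1,2)] disj1[OF vw(2,1)] vw(3,4) by (metis inf_commute)
  qed
  moreover have "?N \<subseteq> {{f, g} |f g. f \<in> faces \<and> g \<in> faces \<and> adjacent f g}"
  proof
    fix e assume "e \<in> ?N"
    then obtain v k where e: "e = {endpoint f v, flip (endpoint f v) k}"
      by (auto simp: strip_net_def)
    have "endpoint f v \<in> faces" using f by simp
    then have "flip (endpoint f v) k \<in> faces" "adjacent (endpoint f v) (flip (endpoint f v) k)"
      using adjacent_iff by auto
    with e \<open>endpoint f v \<in> faces\<close> show "e \<in> {{f, g} |f g. f \<in> faces \<and> g \<in> faces \<and> adjacent f g}" by blast
  qed
  ultimately show ?thesis
    unfolding net_def faces_def[symmetric]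
    using card_strip_net[OF d f] connected_strip_net[OF d f] by blast
qed

section \<open>Strips\<close>

lemma UNIV_ax_distinct: "distinct [a, b, c] \<Longrightarrow> (UNIV :: axis3 set) = {a, b, c}"
  by (cases a; cases b; cases c; simp add: UNIV_ax insert_commute)

lemma sum_distinct_ax:
  fixes a b c :: axis3
  assumes "distinct [a, b, c]"
  shows "(\<Sum>k\<in>UNIV. h k) = h a + h b + h c"
  unfolding UNIV_ax_distinct[OF assms] using assms by (simp add: add.assoc)

lemma ex_third_ax: "\<exists>c::axis3. c \<noteq> a \<and> c \<noteq> b"
proof -
  have "\<exists>c\<in>{X, Y, Z}. c \<noteq> a \<and> c \<noteq> b" by (cases a; cases b) simp_all
  then show ?thesis by blast
qed

text \<open>There are only three axes, so such a word is a prefix of an arrangement of all of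
  them.\<close>

lemma distinct_word_cases:
  fixes w :: "axis3 list"
  assumes "distinct w" "w \<noteq> []"
  obtains a b c where "distinct [a, b, c]" "w = [a] \<or> w = [a, b] \<or> w = [a, b, c]"
proof -
  have "card (set w) \<le> card (UNIV :: axis3 set)" by (rule card_mono) auto
  then have "length w \<le> 3" using distinct_card[OF assms(1)] by (simp add: UNIV_ax)
  with assms(2) consider a where "w = [a]" | a b where "w = [a, b]" | a b c where "w = [a, b, c]"
  proof (cases w)
    case Nil
    then show ?thesis using assms(2) by simp
  next
    case (Cons a w')
    show ?thesis
    proof (cases w')
      case (Cons b w'')
      then show ?thesis
        using \<open>w = a # w'\<close> \<open>length w \<le> 3\<close> that by (cases w'') auto
    qed (use \<open>w = a # w'\<close> that in auto)
  qed
  then show thesis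
  proof cases
    case (1 a)
    obtain b where "b \<noteq> a" using ex_third_ax[of a a] by blast
    moreover obtain c where "c \<noteq> a" "c \<noteq> b" using ex_third_ax[of a b] by blast
    ultimately show thesis using that[of a b c] 1 by auto
  next
    case (2 a b)
    moreover obtain c where "c \<noteq> a" "c \<noteq> b" using ex_third_ax[of a b] by blast
    ultimately show thesis using that[of a b c] assms by auto
  next
    case (3 a b c)
    then show thesis using that[of a b c] assms by auto
  qed
qed

lemma distinct_walk_strip:
  assumes "distinct w" "f \<in> faces"
  shows "distinct (walk f w)"
proof -
  have "list_all (\<lambda>s. distinct (walk 1 s)) axis_perms" by code_simp
  then have p: "distinct (walk f [a, b, c])" if "distinct [a, b, c]" for a b c
    using distinct_perms[OF that] unfolding distinct_walk_1[OF assms(2)] list_all_iff by blast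
  show ?thesis
  proof (cases "w = []")
    case False
    then obtain a b c where "distinct [a, b, c]" "w = [a] \<or> w = [a, b] \<or> w = [a, b, c]"
      using distinct_word_cases[OF assms(1)] by blast
    then show ?thesis using p[of a b c] by auto
  qed simp
qed

text \<open>The walk along \<open>[a, b, c]\<close> runs along the strip of the net built for these
  axes.\<close>

lemma landscape_strip:
  assumes "distinct w" "w \<noteq> []" "f \<in> faces"
  shows "landscape (path_edges (walk f w))"
proof -
  obtain a b c where d: "distinct [a, b, c]" and w: "w = [a] \<or> w = [a, b] \<or> w = [a, b, c]"
    using distinct_word_cases[OF assms(1,2)] by blast
  have "path_edges (walk f w) \<subseteq> strip_net f a b c"
    using w by (elim disjE) (simp_all add: path_edges_def strip_net_def tree_steps_def)
  moreover have "length (walk f w) \<ge> 2" using assms(2) by (cases w) auto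
  ultimately show ?thesis
    unfolding landscape_def
    using net_strip_net[OF d assms(3)] distinct_walk_strip[OF assms(1,3)] by blast
qed

lemma layout_mono:
  "layout Fs E \<phi> \<Longrightarrow> Fs' \<subseteq> Fs \<Longrightarrow> E' \<subseteq> E \<Longrightarrow> layout Fs' E' \<phi>"
  unfolding layout_def by (meson subsetD)

lemma start_in_walk [simp]: "f \<in> set (walk f w)"
  by (cases w) auto

lemma endpoint_in_walk [simp]: "endpoint f w \<in> set (walk f w)"
  by (metis last_in_set last_walk walk_not_Nil)

lemma Union_path_edges_walk: "w \<noteq> [] \<Longrightarrow> \<Union>(path_edges (walk f w)) = set (walk f w)"
proof (induction w arbitrary: f)
  case (Cons k w)
  have "\<Union>(path_edges (walk (flip f k) w)) \<union> {flip f k} = set (walk (flip f k) w)"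
    using Cons.IH by (cases "w = []") (auto simp: path_edges_walk(1)[simplified])
  then show ?case unfolding path_edges_walk by auto
qed simp

lemma bary_in_image:
  assumes \<phi>: "layout Fs E \<phi>" "h \<in> Fs" "h \<in> faces" and l: "\<And>k. 0 \<le> l k" "(\<Sum>k\<in>UNIV. l k) = 1"
  shows "(\<Sum>k\<in>UNIV. l k *\<^sub>R \<phi> h (corner h k)) \<in> \<phi> h ` face h"
proof
  let ?x = "\<Sum>k\<in>UNIV. l k *\<^sub>R corner h k"
  have b: "bary h ?x = l"
  proof
    show "bary h ?x j = l j" for j
      by (simp add: bary_def sum_component corner_nth if_distrib cong: if_cong)
  qed
  show "?x \<in> face h" using l by (simp add: face_iff[OF \<phi>(3)] b)
  then show "(\<Sum>k\<in>UNIV. l k *\<^sub>R \<phi> h (corner h k)) = \<phi> h ?x"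
    using layout_bary[OF \<phi>] by (simp add: b)
qed

text \<open>For sides \<open>U\<close>, \<open>V\<close> of a unit triangle at \<open>A\<close>, the
  pairs \<open>(1, 2)\<close>, \<open>(2, 2)\<close>, \<open>(2, 3)\<close> for
  \<open>(m, n)\<close> give the rhombus, trapezoid and parallelogram made of two, three and four
  triangles.\<close>

definition strip_region :: "complex \<Rightarrow> complex \<Rightarrow> complex \<Rightarrow> real \<Rightarrow> real \<Rightarrow> complex set" where
  "strip_region A U V m n =
    {A + x *\<^sub>R U + y *\<^sub>R V | x y. 0 \<le> x \<and> x \<le> m \<and> 0 \<le> y \<and> y \<le> 1 \<and> x + y \<le> n}"

lemma convex_strip_region: "convex (strip_region A U V m n)"
proof (rule convexI)
  fix P Q u v assume "P \<in> strip_region A U V m n" "Q \<in> strip_region A U V m n"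
    and uv: "0 \<le> (u::real)" "0 \<le> v" "u + v = 1"
  then obtain x y x' y' where
    P: "P = A + x *\<^sub>R U + y *\<^sub>R V" "0 \<le> x" "x \<le> m" "0 \<le> y" "y \<le> 1" "x + y \<le> n" and
    Q: "Q = A + x' *\<^sub>R U + y' *\<^sub>R V" "0 \<le> x'" "x' \<le> m" "0 \<le> y'" "y' \<le> 1" "x' + y' \<le> n"
    unfolding strip_region_def by blast
  have v: "v = 1 - u" using uv by simp
  have "u *\<^sub>R P + v *\<^sub>R Q = A + (u * x + v * x') *\<^sub>R U + (u * y + v * y') *\<^sub>R V"
    unfolding P(1) Q(1) v by (simp add: algebra_simps)
  moreover have "u * x + v * x' \<le> m" "u * y + v * y' \<le> 1" "u * (x + y) + v * (x' + y') \<le> n"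
    by (intro convex_bound_le P Q uv)+
  moreover have "0 \<le> u * x + v * x'" "0 \<le> u * y + v * y'"
    using P Q uv by simp_all
  ultimately show "u *\<^sub>R P + v *\<^sub>R Q \<in> strip_region A U V m n"
    unfolding strip_region_def
    by (intro CollectI exI[of _ "u * x + v * x'"] exI[of _ "u * y + v * y'"]) (simp add: algebra_simps)
qed

text \<open>Both end points lie in a \<open>strip_region\<close>, which is convex and covered by the
  faces of the walk.\<close>

lemma strip_segment:
  assumes \<phi>: "layout Fs E \<phi>" and f: "f \<in> faces" "set (walk f w) \<subseteq> Fs" "path_edges (walk f w) \<subseteq> E"
    and w: "distinct w" "w \<noteq> []" and p: "p \<in> face f" and q: "q \<in> face (endpoint f w)"
  shows "closed_segment (\<phi> f p) (\<phi> (endpoint f w) q) \<subseteq> (\<Union>h\<in>set (walk f w). \<phi> h ` face h)"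
proof -
  obtain a b c where d: "distinct [a, b, c]" and w3: "w = [a] \<or> w = [a, b] \<or> w = [a, b, c]"
    using distinct_word_cases[OF w] by blast
  define A U V where "A = \<phi> f (corner f a)" "U = \<phi> f (corner f c) - A" "V = \<phi> f (corner f b) - A"
  note AUV = this
  \<comment> \<open>In the coordinates given by \<open>U\<close> and \<open>V\<close>, the corners on the axes \<open>a\<close>, \<open>b\<close>, \<open>c\<close> are initially
    \<open>(0,0)\<close>, \<open>(0,1)\<close>, \<open>(1,0)\<close>; then \<open>a\<close> moves to \<open>(1,1)\<close>, \<open>b\<close> to \<open>(2,0)\<close> and \<open>c\<close> to \<open>(2,1)\<close>.\<close>
  have tot: "proj X s + proj Y s + proj Z s = proj a s + proj b s + proj c s" for s :: "complex \<times> complex \<times> complex"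
    using sum_distinct_ax[OF d, of "\<lambda>k. proj k s"] unfolding sum_ax .
  have ne: "a \<noteq> b" "b \<noteq> a" "a \<noteq> c" "c \<noteq> a" "b \<noteq> c" "c \<noteq> b" using d by auto
  define P where "P h k = \<phi> h (corner h k)" for h k
  have P: "P h k = proj k (frame \<phi> h)" for h k by (simp add: P_def)
  have P0: "P f a = A" "P f b = A + V" "P f c = A + U" by (simp_all add: P_def AUV)
  have mem: "A + x *\<^sub>R U + y *\<^sub>R V \<in> \<phi> h ` face h"
    if "h \<in> set (walk f w)" "0 \<le> la" "0 \<le> lb" "0 \<le> lc" "la + lb + lc = 1"
      "A + x *\<^sub>R U + y *\<^sub>R V = la *\<^sub>R P h a + lb *\<^sub>R P h b + lc *\<^sub>R P h c" for h x y la lb lc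
  proof -
    define l where "l k = (if k = a then la else if k = b then lb else lc)" for k
    have h: "h \<in> Fs" "h \<in> faces" using that(1) f(2) set_walk[OF f(1)] by auto
    have "(\<Sum>k\<in>UNIV. l k *\<^sub>R \<phi> h (corner h k)) \<in> \<phi> h ` face h"
      by (rule bary_in_image[OF \<phi> h]) (use that ne in \<open>auto simp: l_def sum_distinct_ax[OF d]\<close>)
    then show ?thesis
      using that(6) ne by (simp add: sum_distinct_ax[OF d] l_def P_def)
  qed
  have pt: "\<phi> h x = bary h x a *\<^sub>R P h a + bary h x b *\<^sub>R P h b + bary h x c *\<^sub>R P h c"
    "0 \<le> bary h x k" "bary h x a + bary h x b + bary h x c = 1"
    if "h \<in> set (walk f w)" "x \<in> face h" for h x k
  proof -
    have h: "h \<in> Fs" "h \<in> faces" using that(1) f(2) set_walk[OF f(1)] by auto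
    show "\<phi> h x = bary h x a *\<^sub>R P h a + bary h x b *\<^sub>R P h b + bary h x c *\<^sub>R P h c"
      using layout_bary[OF \<phi> h that(2)] by (simp add: sum_distinct_ax[OF d] P_def)
    show "0 \<le> bary h x k" "bary h x a + bary h x b + bary h x c = 1"
      using face_iff[OF h(2)] that(2) by (auto simp: sum_distinct_ax[OF d])
  qed
  note fw = start_in_walk[of f w]
  note p' = pt[OF fw p] and q' = pt[OF endpoint_in_walk q]
  have pa: "bary f p a = 1 - bary f p b - bary f p c" using p'(3) by linarith
  have qa: "bary (endpoint f w) q a = 1 - bary (endpoint f w) q b - bary (endpoint f w) q c"
    using q'(3) by linarith
  have pS: "\<phi> f p \<in> strip_region A U V m n" if "1 \<le> m" "1 \<le> n" for m n
    unfolding strip_region_def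
    using p'(3) p'(2)[of a] p'(2)[of b] p'(2)[of c] that
    by (intro CollectI exI[of _ "bary f p c"] exI[of _ "bary f p b"])
       (simp add: p'(1) P0 pa algebra_simps)
  \<comment> \<open>\<open>T0\<close> to \<open>T3\<close> match the successive triangles with the
    pieces into which the lines x + y = 1, x = 1 and x + y = 2 cut the region.\<close>
  have T0: "A + x *\<^sub>R U + y *\<^sub>R V \<in> (\<Union>h\<in>set (walk f w). \<phi> h ` face h)"
    if "0 \<le> x" "0 \<le> y" "x + y \<le> 1" for x y
    by (rule UN_I[OF fw], rule mem[OF fw, of "1 - x - y" y x]) (use that in \<open>auto simp: P0 algebra_simps\<close>)
  let ?f1 = "flip f a" and ?f2 = "flip (flip f a) b" and ?f3 = "flip (flip (flip f a) b) c"
  have w1: "?f1 \<in> set (walk f w)" using w3 by auto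
  have fr: "frame \<phi> (endpoint f v) = fold step v (frame \<phi> f)" if "v @ x = w" for v x
  proof (rule frame_endpoint[OF \<phi> f(1)])
    show "set (walk f v) \<subseteq> Fs" "path_edges (walk f v) \<subseteq> E"
      using f(2,3) w3 that by (auto simp: path_edges_def append_eq_Cons_conv)
  qed
  have stepP: "P (flip (endpoint f v) k) j = (if j = k then P (endpoint f v) a + P (endpoint f v) b +
      P (endpoint f v) c - P (endpoint f v) k - P (endpoint f v) k else P (endpoint f v) j)"
    if "v @ k # x = w" for v k x j
  proof -
    have "frame \<phi> (flip (endpoint f v) k) = step k (frame \<phi> (endpoint f v))"
      using fr[of "v @ [k]" x] fr[of v "k # x"] that by simp
    then show ?thesis unfolding P by (simp only: proj_step tot)
  qed
  have P1: "P ?f1 a = A + U + V" "P ?f1 b = A + V" "P ?f1 c = A + U"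
    using stepP[of "[]" a "tl w"] w3 ne by (auto simp: P0)
  have T1: "A + x *\<^sub>R U + y *\<^sub>R V \<in> (\<Union>h\<in>set (walk f w). \<phi> h ` face h)"
    if "x \<le> 1" "y \<le> 1" "1 \<le> x + y" for x y
    by (rule UN_I[OF w1], rule mem[OF w1, of "x + y - 1" "1 - x" "1 - y"])
       (use that in \<open>auto simp: P1 algebra_simps\<close>)
  have P2: "P ?f2 a = A + U + V" "P ?f2 b = A + 2 *\<^sub>R U" "P ?f2 c = A + U" if "w \<noteq> [a]"
    using stepP[of "[a]" b "tl (tl w)"] w3 that ne by (auto simp: P1 scaleR_2)
  have T2: "A + x *\<^sub>R U + y *\<^sub>R V \<in> (\<Union>h\<in>set (walk f w). \<phi> h ` face h)"
    if "w \<noteq> [a]" "1 \<le> x" "0 \<le> y" "x + y \<le> 2" for x y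
  proof -
    have w2: "?f2 \<in> set (walk f w)" using w3 that by auto
    show ?thesis
      by (rule UN_I[OF w2], rule mem[OF w2, of y "x - 1" "2 - x - y"])
         (use that in \<open>auto simp: P2 algebra_simps scaleR_2\<close>)
  qed
  have P3: "P ?f3 a = A + U + V" "P ?f3 b = A + 2 *\<^sub>R U" "P ?f3 c = A + 2 *\<^sub>R U + V"
    if "w = [a, b, c]"
    using stepP[of "[a, b]" c "[]"] that ne by (auto simp: P2 scaleR_2)
  have "\<exists>m n. 1 \<le> m \<and> 1 \<le> n \<and> \<phi> (endpoint f w) q \<in> strip_region A U V m n \<and>
      strip_region A U V m n \<subseteq> (\<Union>h\<in>set (walk f w). \<phi> h ` face h)"
    using w3
  proof (elim disjE)
    assume "w = [a]"
    then have e: "endpoint f w = ?f1" by simp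
    show ?thesis
    proof (rule exI[of _ 1], rule exI[of _ 2], intro conjI)
      \<comment> \<open>The witnesses are the coordinates of the corners in \<open>P1\<close>,
        weighted by the barycentric coordinates of \<open>q\<close>; likewise below with
        \<open>P2\<close> and \<open>P3\<close>.\<close>
      show "\<phi> (endpoint f w) q \<in> strip_region A U V 1 2"
        unfolding strip_region_def
        using q'(3) q'(2)[of a] q'(2)[of b] q'(2)[of c] unfolding q'(1) unfolding e P1
        by (intro CollectI exI[of _ "bary ?f1 q a + bary ?f1 q c"] exI[of _ "bary ?f1 q a + bary ?f1 q b"])
           (simp add: qa[unfolded e] algebra_simps scaleR_2)
      show "strip_region A U V 1 2 \<subseteq> (\<Union>h\<in>set (walk f w). \<phi> h ` face h)"
      proof
        fix z assume "z \<in> strip_region A U V 1 2"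
        then obtain x y where "z = A + x *\<^sub>R U + y *\<^sub>R V" "0 \<le> x" "x \<le> 1" "0 \<le> y" "y \<le> 1" "x + y \<le> 2"
          unfolding strip_region_def by blast
        then show "z \<in> (\<Union>h\<in>set (walk f w). \<phi> h ` face h)"
          using T0[of x y] T1[of x y] by (cases "x + y \<le> 1") auto
      qed
    qed auto
  next
    assume wab: "w = [a, b]"
    then have e: "endpoint f w = ?f2" and wab': "w \<noteq> [a]" by simp_all
    show ?thesis
    proof (rule exI[of _ 2], rule exI[of _ 2], intro conjI)
      show "\<phi> (endpoint f w) q \<in> strip_region A U V 2 2"
        unfolding strip_region_def
        using q'(3) q'(2)[of a] q'(2)[of b] q'(2)[of c] unfolding q'(1) unfolding e P2[OF wab']
        by (intro CollectI exI[of _ "bary ?f2 q a + 2 * bary ?f2 q b + bary ?f2 q c"] exI[of _ "bary ?f2 q a"])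
           (simp add: qa[unfolded e] algebra_simps scaleR_2)
      show "strip_region A U V 2 2 \<subseteq> (\<Union>h\<in>set (walk f w). \<phi> h ` face h)"
      proof
        fix z assume "z \<in> strip_region A U V 2 2"
        then obtain x y where "z = A + x *\<^sub>R U + y *\<^sub>R V" "0 \<le> x" "x \<le> 2" "0 \<le> y" "y \<le> 1" "x + y \<le> 2"
          unfolding strip_region_def by blast
        then show "z \<in> (\<Union>h\<in>set (walk f w). \<phi> h ` face h)"
          using T0[of x y] T1[of x y] T2[of x y] wab by (cases "x + y \<le> 1"; cases "x \<le> 1") auto
      qed
    qed auto
  next
    assume wabc: "w = [a, b, c]"
    then have e: "endpoint f w = ?f3" by simp
    have w3': "?f3 \<in> set (walk f w)" using wabc by simp
    have T3: "A + x *\<^sub>R U + y *\<^sub>R V \<in> (\<Union>h\<in>set (walk f w). \<phi> h ` face h)"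
      if "x \<le> 2" "y \<le> 1" "2 \<le> x + y" for x y
      by (rule UN_I[OF w3'], rule mem[OF w3', of "2 - x" "1 - y" "x + y - 2"])
         (use that in \<open>auto simp: P3[OF wabc] algebra_simps scaleR_2\<close>)
    show ?thesis
    proof (rule exI[of _ 2], rule exI[of _ 3], intro conjI)
      show "\<phi> (endpoint f w) q \<in> strip_region A U V 2 3"
        unfolding strip_region_def
        using q'(3) q'(2)[of a] q'(2)[of b] q'(2)[of c] unfolding q'(1) unfolding e P3[OF wabc]
        by (intro CollectI exI[of _ "bary ?f3 q a + 2 * bary ?f3 q b + 2 * bary ?f3 q c"] exI[of _ "bary ?f3 q a + bary ?f3 q c"])
           (simp add: qa[unfolded e] algebra_simps scaleR_2)
      show "strip_region A U V 2 3 \<subseteq> (\<Union>h\<in>set (walk f w). \<phi> h ` face h)"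
      proof
        fix z assume "z \<in> strip_region A U V 2 3"
        then obtain x y where "z = A + x *\<^sub>R U + y *\<^sub>R V" "0 \<le> x" "x \<le> 2" "0 \<le> y" "y \<le> 1" "x + y \<le> 3"
          unfolding strip_region_def by blast
        then show "z \<in> (\<Union>h\<in>set (walk f w). \<phi> h ` face h)"
          using T0[of x y] T1[of x y] T2[of x y] T3[of x y] wabc by (cases "x + y \<le> 1"; cases "x \<le> 1"; cases "x + y \<le> 2") auto
      qed
    qed auto
  qed
  then obtain m n where mn: "1 \<le> m" "1 \<le> n" "\<phi> (endpoint f w) q \<in> strip_region A U V m n"
      "strip_region A U V m n \<subseteq> (\<Union>h\<in>set (walk f w). \<phi> h ` face h)" by blast
  have "closed_segment (\<phi> f p) (\<phi> (endpoint f w) q) \<subseteq> strip_region A U V m n"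
    by (rule closed_segment_subset[OF pS[OF mn(1,2)] mn(3) convex_strip_region])
  with mn(4) show ?thesis by blast
qed

section \<open>Upper bounds for trail lengths\<close>

lemma landscape_layout:
  assumes "landscape L"
  obtains \<phi> where "layout {1..8} L \<phi>"
  using assms layout_mono unfolding landscape_def net_def by (metis order_refl)

text \<open>The straight segment stays inside the strip, so its length is one of the values in the
  infimum.\<close>

lemma trail_strip:
  assumes f: "f \<in> faces" and w: "distinct w" "w \<noteq> []" and p: "p \<in> face f" and q: "q \<in> face (endpoint f w)"
  shows "trail_length (path_edges (walk f w)) p q \<le> ereal (sqrt (sqdist_bary w (bary f p) (bary (endpoint f w) q)))"
proof -
  let ?L = "path_edges (walk f w)" and ?g = "endpoint f w"
  have U: "\<Union>?L = set (walk f w)" using w by (simp add: Union_path_edges_walk)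
  obtain \<phi> where "layout {1..8} ?L \<phi>" using landscape_layout[OF landscape_strip[OF w f]] .
  then have \<phi>: "layout (set (walk f w)) ?L \<phi>"
    using layout_mono set_walk[OF f] unfolding faces_def by blast
  have "(dist (\<phi> f p) (\<phi> ?g q))\<^sup>2 = sqdist_bary w (bary f p) (bary ?g q)"
    by (rule layout_dist_sq[OF \<phi> f _ _ p q]) auto
  then have "sqrt (sqdist_bary w (bary f p) (bary ?g q)) = dist (\<phi> f p) (\<phi> ?g q)"
    by (metis real_sqrt_unique zero_le_dist)
  moreover have "closed_segment (\<phi> f p) (\<phi> ?g q) \<subseteq> (\<Union>h\<in>set (walk f w). \<phi> h ` face h)"
    by (rule strip_segment[OF \<phi> f _ _ w p q]) auto
  ultimately show ?thesis
    unfolding trail_length_def U using \<phi> p q start_in_walk[of f w] endpoint_in_walk[of f w]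
    by (intro Inf_lower CollectI exI[of _ \<phi>] exI[of _ f] exI[of _ ?g]) auto
qed

text \<open>The layout is affine on the convex face, so the segment never leaves the image of that
  face.\<close>

lemma trail_same_face:
  assumes L: "landscape L" and f: "f \<in> faces" "f \<in> \<Union>L" "\<Union>L \<subseteq> faces" and p: "p \<in> face f" and q: "q \<in> face f"
  shows "trail_length L p q \<le> ereal (dist p q)"
proof -
  obtain \<phi> where "layout {1..8} L \<phi>" using landscape_layout[OF L] .
  then have \<phi>: "layout (\<Union>L) L \<phi>"
    using layout_mono f(3) unfolding faces_def by blast
  have "closed_segment (\<phi> f p) (\<phi> f q) \<subseteq> \<phi> f ` face f"
  proof
    fix z assume "z \<in> closed_segment (\<phi> f p) (\<phi> f q)"
    then obtain u where u: "0 \<le> u" "u \<le> 1" "z = (1 - u) *\<^sub>R \<phi> f p + u *\<^sub>R \<phi> f q"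
      unfolding closed_segment_def by blast
    have "(\<Sum>k\<in>UNIV. ((1 - u) * bary f p k + u * bary f q k) *\<^sub>R \<phi> f (corner f k)) \<in> \<phi> f ` face f"
    proof (rule bary_in_image[OF \<phi> f(2,1)])
      show "0 \<le> (1 - u) * bary f p k + u * bary f q k" for k
        using u p q face_iff[OF f(1)] by simp
      show "(\<Sum>k\<in>UNIV. (1 - u) * bary f p k + u * bary f q k) = 1"
        using p q face_iff[OF f(1)] by (simp add: sum.distrib sum_distrib_left[symmetric])
    qed
    moreover have "z = (\<Sum>k\<in>UNIV. ((1 - u) * bary f p k + u * bary f q k) *\<^sub>R \<phi> f (corner f k))"
      unfolding u(3) layout_bary[OF \<phi> f(2,1) p] layout_bary[OF \<phi> f(2,1) q]
      by (simp add: scaleR_sum_right scaleR_add_left sum.distrib)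
    ultimately show "z \<in> \<phi> f ` face f" by simp
  qed
  moreover have "dist p q = dist (\<phi> f p) (\<phi> f q)"
    using layout_isometry[OF \<phi> f(2) p q] by simp
  ultimately show ?thesis
    unfolding trail_length_def using \<phi> p q f(2) by (intro Inf_lower) blast
qed

lemma trail_length_commute: "trail_length L p q = trail_length L q p"
proof -
  define S where "S p q = {ereal (dist (\<phi> f p) (\<phi> g q)) | \<phi> f g.
      layout (\<Union>L) L \<phi> \<and> f \<in> \<Union>L \<and> g \<in> \<Union>L \<and> p \<in> face f \<and> q \<in> face g \<and>
      closed_segment (\<phi> f p) (\<phi> g q) \<subseteq> (\<Union>h\<in>\<Union>L. \<phi> h ` face h)}" for p q
  have sub: "S p q \<subseteq> S q p" for p q
  proof
    fix r assume "r \<in> S p q"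
    then obtain \<phi> f g where r: "r = ereal (dist (\<phi> f p) (\<phi> g q))" "layout (\<Union>L) L \<phi>" "f \<in> \<Union>L" "g \<in> \<Union>L"
      "p \<in> face f" "q \<in> face g" "closed_segment (\<phi> f p) (\<phi> g q) \<subseteq> (\<Union>h\<in>\<Union>L. \<phi> h ` face h)"
      unfolding S_def by blast
    show "r \<in> S q p"
      unfolding S_def
    proof (rule CollectI, rule exI[of _ \<phi>], rule exI[of _ g], rule exI[of _ f], intro conjI)
      show "r = ereal (dist (\<phi> g q) (\<phi> f p))" using r(1) by (simp add: dist_commute)
      show "closed_segment (\<phi> g q) (\<phi> f p) \<subseteq> (\<Union>h\<in>\<Union>L. \<phi> h ` face h)"
        using r(7) by (simp only: closed_segment_commute)
    qed (fact r)+
  qed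
  have "S p q = S q p" using sub[of p q] sub[of q p] by (rule equalityI)
  then show ?thesis unfolding trail_length_def S_def by simp
qed

section \<open>Shortening a path\<close>

lemma walk_prefix:
  "set (walk f v) \<subseteq> set (walk f (v @ x))" "path_edges (walk f v) \<subseteq> path_edges (walk f (v @ x))"
proof -
  show "set (walk f v) \<subseteq> set (walk f (v @ x))" by (simp add: walk_append)
  show "path_edges (walk f v) \<subseteq> path_edges (walk f (v @ x))"
  proof (induction v arbitrary: f)
    case (Cons k v)
    then show ?case unfolding append_Cons path_edges_walk by blast
  qed (simp add: path_edges_def)
qed

lemma walk_suffix:
  "set (walk (endpoint f u) v) \<subseteq> set (walk f (u @ v))"
  "path_edges (walk (endpoint f u) v) \<subseteq> path_edges (walk f (u @ v))"
proof (induction u arbitrary: f)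
  case (Cons k u)
  { case 1 show ?case using Cons(1)[of "flip f k"] by auto }
  { case 2 show ?case unfolding append_Cons path_edges_walk using Cons(2)[of "flip f k"] by auto }
qed simp_all

lemma walk_infix:
  "set (walk (endpoint f u) v) \<subseteq> set (walk f (u @ v @ x))"
  "path_edges (walk (endpoint f u) v) \<subseteq> path_edges (walk f (u @ v @ x))"
  using walk_prefix[of "endpoint f u" v x] walk_suffix[of f u "v @ x"] by auto

lemma distinct_walk_infix:
  assumes "distinct (walk f (u @ v @ x))"
  shows "distinct (walk (endpoint f u) v)"
proof -
  have "distinct (walk f (u @ v)) \<Longrightarrow> distinct (walk (endpoint f u) v)"
    by (induction u arbitrary: f) auto
  then show ?thesis
    using assms walk_append[of f "u @ v" x] by simp
qed

text \<open>The \<open>spread\<close> terms cancel, leaving a sum of nine nonnegative terms, each of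
  which bounds it from below; one positive term will give a strict inequality.\<close>

lemma sqdist_bary_mono:
  assumes l: "\<And>k. 0 \<le> l k" and m: "\<And>k. 0 \<le> m k" and le: "\<And>i j. corner_sqdist w' i j \<le> corner_sqdist w i j"
  shows "l i * m j * of_int (corner_sqdist w i j - corner_sqdist w' i j) \<le> sqdist_bary w l m - sqdist_bary w' l m"
proof -
  have nn: "0 \<le> l i * m j * of_int (corner_sqdist w i j - corner_sqdist w' i j)" for i j
    using l[of i] m[of j] le[of i j] by simp
  have "l i * m j * of_int (corner_sqdist w i j - corner_sqdist w' i j) \<le> (\<Sum>j\<in>UNIV. l i * m j * of_int (corner_sqdist w i j - corner_sqdist w' i j))"
    by (rule member_le_sum) (simp, rule nn, simp)
  also have "\<dots> \<le> (\<Sum>i\<in>UNIV. \<Sum>j\<in>UNIV. l i * m j * of_int (corner_sqdist w i j - corner_sqdist w' i j))"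
    by (rule member_le_sum) (simp, rule sum_nonneg, rule nn, simp)
  also have "\<dots> = sqdist_bary w l m - sqdist_bary w' l m"
    unfolding sqdist_bary_def by (simp add: right_diff_distrib sum_subtractf)
  finally show ?thesis .
qed

text \<open>A vanishing coordinate on axis \<open>k\<close> puts \<open>p\<close> on the edge
  crossed by this flip.\<close>

lemma face_flip:
  assumes f: "f \<in> faces" and p: "p \<in> face f" and z: "bary f p k = 0"
  shows "p \<in> face (flip f k)"
proof -
  have "bary (flip f k) p j = bary f p j" for j
    using z by (auto simp: bary_def axis_sign_flip[OF f])
  then show ?thesis using p face_iff[OF f] face_iff[OF flip_in[OF f]] by simp
qed

text \<open>Induction on the length of the word, with the layout kept fixed. The last conclusion
  mirrors the two ways to refute validity: a strictly shorter trail, or one that is no longer and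
  belongs to a sublandscape.\<close>

lemma reduce_to_strip:
  assumes \<phi>: "layout Fs E \<phi>" and f: "f \<in> faces"
    and w: "set (walk f w) \<subseteq> Fs" "path_edges (walk f w) \<subseteq> E" "distinct (walk f w)" "w \<noteq> []"
    and p: "p \<in> face f" and q: "q \<in> face (endpoint f w)"
  obtains f' w' where "f' \<in> faces" "distinct w'" "w' \<noteq> []" "p \<in> face f'" "q \<in> face (endpoint f' w')"
    "sqdist_bary w' (bary f' p) (bary (endpoint f' w') q) \<le> (dist (\<phi> f p) (\<phi> (endpoint f w) q))\<^sup>2"
    "sqdist_bary w' (bary f' p) (bary (endpoint f' w') q) < (dist (\<phi> f p) (\<phi> (endpoint f w) q))\<^sup>2 \<or>
      (\<exists>u x. w = u @ w' @ x \<and> f' = endpoint f u)"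
proof -
  have "\<exists>f' w'. f' \<in> faces \<and> distinct w' \<and> w' \<noteq> [] \<and> p \<in> face f' \<and> q \<in> face (endpoint f' w') \<and>
    sqdist_bary w' (bary f' p) (bary (endpoint f' w') q) \<le> (dist (\<phi> f p) (\<phi> (endpoint f w) q))\<^sup>2 \<and>
    (sqdist_bary w' (bary f' p) (bary (endpoint f' w') q) < (dist (\<phi> f p) (\<phi> (endpoint f w) q))\<^sup>2 \<or>
      (\<exists>u x. w = u @ w' @ x \<and> f' = endpoint f u))"
    using f w p q
  proof (induction w arbitrary: f rule: length_induct)
    case (1 w)
    note f = 1(2) and w = 1(3-6) and p = 1(7) and q = 1(8)
    let ?g = "endpoint f w"
    have g: "?g \<in> faces" using f by simp
    have dist: "(dist (\<phi> f p) (\<phi> ?g q))\<^sup>2 = sqdist_bary w (bary f p) (bary ?g q)"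
      by (rule layout_dist_sq[OF \<phi> f w(1,2) p q])
    have glue: "\<phi> h x = \<phi> (flip h k) x"
      if "{h, flip h k} \<in> E" "x \<in> face h" "x \<in> face (flip h k)" for h k x
      using \<phi> that unfolding layout_def by blast
    show ?case
    proof (cases "distinct w")
      case True
      then show ?thesis
        using f w(4) p q dist by (intro exI[of _ f] exI[of _ w]) (auto intro!: exI[of _ "[]"])
    next
      case False
      have pos: "0 \<le> bary f p k" "0 \<le> bary ?g q k" for k
        using face_iff[OF f] face_iff[OF g] p q by auto
      obtain w' where w': "w' \<noteq> []" "distinct w'" "endpoint f w' = ?g"
        "\<And>i j. corner_sqdist w' i j \<le> corner_sqdist w i j" "corner_sqdist w' (hd w) (last w) < corner_sqdist w (hd w) (last w)"
        using ex_better[OF f w(3) False] by blast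
      note le = sqdist_bary_mono[of "bary f p" "bary ?g q" w' w, OF pos w'(4)]
      \<comment> \<open>If neither point lies on its crossed edge, the term at the strict pair of
        corners is positive. Otherwise an end face is dropped; the edge is glued, so the image of
        the point does not move.\<close>
      consider "bary f p (hd w) \<noteq> 0" "bary ?g q (last w) \<noteq> 0"
        | "bary f p (hd w) = 0" | "bary ?g q (last w) = 0" by blast
      then show ?thesis
      proof cases
        case 1
        then have "0 < bary f p (hd w) * bary ?g q (last w) * of_int (corner_sqdist w (hd w) (last w) - corner_sqdist w' (hd w) (last w))"
          using pos(1)[of "hd w"] pos(2)[of "last w"] w'(5) by (intro mult_pos_pos) auto
        with le[of "hd w" "last w"]
        have "sqdist_bary w' (bary f p) (bary ?g q) < (dist (\<phi> f p) (\<phi> ?g q))\<^sup>2"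
          unfolding dist by linarith
        then show ?thesis using f w' p q by (intro exI[of _ f] exI[of _ w']) auto
      next
        case 2
        obtain k v where kv: "w = k # v" using w(4) by (cases w) auto
        \<comment> \<open>A word of one letter has no repetition.\<close>
        with False have v: "v \<noteq> []" by auto
        let ?f = "flip f k"
        have pf: "p \<in> face ?f" using face_flip[OF f p] 2 kv by simp
        have sub: "path_edges (walk ?f v) \<subseteq> E" "{f, ?f} \<in> E"
          using w(2) unfolding kv path_edges_walk by auto
        have eq: "\<phi> ?f p = \<phi> f p" using glue[OF sub(2) p pf] by simp
        obtain f' w'' where *: "f' \<in> faces" "distinct w''" "w'' \<noteq> []" "p \<in> face f'" "q \<in> face (endpoint f' w'')"
          "sqdist_bary w'' (bary f' p) (bary (endpoint f' w'') q) \<le> (dist (\<phi> ?f p) (\<phi> (endpoint ?f v) q))\<^sup>2"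
          "sqdist_bary w'' (bary f' p) (bary (endpoint f' w'') q) < (dist (\<phi> ?f p) (\<phi> (endpoint ?f v) q))\<^sup>2 \<or>
            (\<exists>u x. v = u @ w'' @ x \<and> f' = endpoint ?f u)"
          using 1(1)[rule_format, of v ?f] f w v pf q sub unfolding kv by auto
        have "(\<exists>u x. w = u @ w'' @ x \<and> f' = endpoint f u)"
          if "v = u @ w'' @ x" "f' = endpoint ?f u" for u x
          using that kv by (intro exI[of _ "k # u"] exI[of _ x]) auto
        with * show ?thesis unfolding eq by (intro exI[of _ f'] exI[of _ w'']) (auto simp: kv)
      next
        case 3
        obtain k v where kv: "w = v @ [k]" using w(4) by (cases w rule: rev_cases) auto
        with False have v: "v \<noteq> []" by auto
        let ?h = "endpoint f v"
        have h: "?h \<in> faces" using f by simp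
        have gh: "?g = flip ?h k" by (simp add: kv)
        have hg: "?h = flip ?g k" unfolding gh flip_flip[OF h] ..
        have qh: "q \<in> face ?h" using face_flip[OF g q, of k] 3 unfolding hg[symmetric] by (simp add: kv)
        have "{?h, flip ?h k} \<in> path_edges (walk f w)"
          using walk_suffix(2)[of f v "[k]"] unfolding path_edges_walk kv by auto
        then have eq: "\<phi> ?h q = \<phi> ?g q"
          using glue[of ?h k q] qh q gh w(2) by auto
        have sub: "path_edges (walk f v) \<subseteq> E" "set (walk f v) \<subseteq> Fs" "distinct (walk f v)"
          using walk_prefix[of f v "[k]"] distinct_walk_infix[of f "[]" v "[k]"] w unfolding kv by auto
        obtain f' w'' where *: "f' \<in> faces" "distinct w''" "w'' \<noteq> []" "p \<in> face f'" "q \<in> face (endpoint f' w'')"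
          "sqdist_bary w'' (bary f' p) (bary (endpoint f' w'') q) \<le> (dist (\<phi> f p) (\<phi> ?h q))\<^sup>2"
          "sqdist_bary w'' (bary f' p) (bary (endpoint f' w'') q) < (dist (\<phi> f p) (\<phi> ?h q))\<^sup>2 \<or>
            (\<exists>u x. v = u @ w'' @ x \<and> f' = endpoint f u)"
          using 1(1)[rule_format, of v f] f sub v p qh unfolding kv by auto
        have "(\<exists>u x. w = u @ w'' @ x \<and> f' = endpoint f u)"
          if "v = u @ w'' @ x" "f' = endpoint f u" for u x
          using that kv by (intro exI[of _ u] exI[of _ "x @ [k]"]) auto
        with * show ?thesis unfolding eq by (intro exI[of _ f'] exI[of _ w'']) auto
      qed
    qed
  qed
  then show thesis using that by blast
qed

section \<open>Competitors of a landscape with a repeated axis\<close>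

lemma in_walk_iff: "h \<in> set (walk f w) \<longleftrightarrow> (\<exists>u x. w = u @ x \<and> h = endpoint f u)"
proof
  assume "h \<in> set (walk f w)"
  then show "\<exists>u x. w = u @ x \<and> h = endpoint f u"
  proof (induction w arbitrary: f)
    case (Cons k w)
    show ?case
    proof (cases "h = f")
      case False
      then have "h \<in> set (walk (flip f k) w)" using Cons.prems by simp
      then obtain u x where "w = u @ x" "h = endpoint (flip f k) u" using Cons.IH by blast
      then show ?thesis by (intro exI[of _ "k # u"] exI[of _ x]) auto
    qed (intro exI[of _ "[]"] exI[of _ "k # w"], simp)
  qed auto
next
  assume "\<exists>u x. w = u @ x \<and> h = endpoint f u"
  then show "h \<in> set (walk f w)"
    using walk_prefix(1) endpoint_in_walk by blast
qed

text \<open>The two faces correspond to prefixes of the word, and of two prefixes one extends the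
  other.\<close>

lemma in_walk_pairE:
  assumes "f \<in> set (walk f0 w)" "g \<in> set (walk f0 w)"
  obtains u v x where "w = u @ v @ x" "f = endpoint f0 u" "g = endpoint f0 (u @ v)"
    | u v x where "w = u @ v @ x" "g = endpoint f0 u" "f = endpoint f0 (u @ v)"
proof -
  obtain u x u' x' where u: "w = u @ x" "f = endpoint f0 u" and u': "w = u' @ x'" "g = endpoint f0 u'"
    using assms unfolding in_walk_iff by blast
  then have "u @ x = u' @ x'" by simp
  then obtain v where "u = u' @ v \<and> v @ x = x' \<or> u @ v = u' \<and> x = v @ x'"
    unfolding append_eq_append_conv2 by blast
  then show thesis
  proof (elim disjE conjE)
    assume "u = u' @ v" "v @ x = x'"
    then show thesis using that(2)[of u' v x] u u' by simp
  next
    assume "u @ v = u'" "x = v @ x'"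
    then show thesis using that(1)[of u v x'] u u' by simp
  qed
qed

text \<open>The faces supplying the images of \<open>p\<close> and \<open>q\<close> need not be end
  faces, so the infix \<open>v\<close> between them is reduced.\<close>

lemma competitor_ordered:
  assumes f0: "f0 \<in> faces" and d: "distinct (walk f0 w0)" and nd: "\<not> distinct w0"
    and \<phi>: "layout (set (walk f0 w0)) (path_edges (walk f0 w0)) \<phi>"
    and w0: "w0 = u @ v @ x"
    and p: "p \<in> face (endpoint f0 u)" and q: "q \<in> face (endpoint f0 (u @ v))"
  obtains L' where "landscape L'" "p \<in> region L'" "q \<in> region L'"
    "trail_length L' p q \<le> ereal (dist (\<phi> (endpoint f0 u) p) (\<phi> (endpoint f0 (u @ v)) q))"
    "trail_length L' p q < ereal (dist (\<phi> (endpoint f0 u) p) (\<phi> (endpoint f0 (u @ v)) q)) \<or>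
      L' \<subset> path_edges (walk f0 w0)"
proof -
  let ?f = "endpoint f0 u" and ?L = "path_edges (walk f0 w0)"
  have f: "?f \<in> faces" using f0 by simp
  \<comment> \<open>A repetition-free infix differs from \<open>w0\<close>, hence is shorter and
    covers fewer faces.\<close>
  have proper: "path_edges (walk (endpoint f0 u') w') \<subset> ?L"
    if "w0 = u' @ w' @ x'" "distinct w'" "w' \<noteq> []" for u' w' x'
  proof -
    have "w' \<noteq> w0" using that(2) nd by blast
    then have "length w' < length w0" using that(1) by auto
    then have "card (set (walk (endpoint f0 u') w')) < card (set (walk f0 w0))"
      using card_length[of "walk (endpoint f0 u') w'"] distinct_card[OF d] by simp
    moreover have "w0 \<noteq> []" using nd by auto
    ultimately have "path_edges (walk (endpoint f0 u') w') \<noteq> ?L"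
      using Union_path_edges_walk that(3) by (metis less_irrefl)
    then show ?thesis using walk_infix(2)[of f0 u' w' x'] that(1) by blast
  qed
  have reg: "p \<in> region (path_edges (walk f' w'))"
    if "w' \<noteq> []" "h \<in> set (walk f' w')" "p \<in> face h" for p f' w' h
    using that unfolding region_def Union_path_edges_walk[OF that(1)] by blast
  show thesis
  proof (cases "v = []")
    case True
    \<comment> \<open>Both images lie in one face; a single crossing into or out of it gives a
      sublandscape of two faces containing both points.\<close>
    obtain u' k x' where k: "w0 = u' @ [k] @ x'" "?f \<in> set (walk (endpoint f0 u') [k])"
    proof (cases x)
      case Nil
      then have "u \<noteq> []" using True w0 nd by auto
      then obtain u' k where "u = u' @ [k]" by (cases u rule: rev_cases) auto
      then show thesis using that[of u' k "[]"] w0 True Nil by simp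
    next
      case (Cons k x')
      then show thesis using that[of u k x'] w0 True by simp
    qed
    let ?M = "path_edges (walk (endpoint f0 u') [k])"
    have U: "\<Union>?M = set (walk (endpoint f0 u') [k])" by (rule Union_path_edges_walk) simp
    have M: "landscape ?M" by (rule landscape_strip) (use f0 in auto)
    have q': "q \<in> face ?f" using q True by simp
    have "?f \<in> set (walk f0 w0)" using walk_infix(1)[of f0 u' "[k]" x'] k by auto
    then have "dist (\<phi> ?f p) (\<phi> ?f q) = dist p q"
      using layout_isometry[OF \<phi> _ p q'] by simp
    moreover have "trail_length ?M p q \<le> ereal (dist p q)"
      by (rule trail_same_face[OF M f _ _ p q']) (use U k(2) set_walk[of "endpoint f0 u'" "[k]"] f0 in auto)
    ultimately show thesis
      using that[OF M reg[OF _ k(2) p] reg[OF _ k(2) q']] proper[OF k(1)] True by simp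
  next
    case False
    have sub: "set (walk ?f v) \<subseteq> set (walk f0 w0)" "path_edges (walk ?f v) \<subseteq> ?L" "distinct (walk ?f v)"
      using walk_infix[of f0 u v x] distinct_walk_infix[of f0 u v x] d unfolding w0 by auto
    have q': "q \<in> face (endpoint ?f v)" using q by simp
    obtain f' w' where *: "f' \<in> faces" "distinct w'" "w' \<noteq> []" "p \<in> face f'" "q \<in> face (endpoint f' w')"
      "sqdist_bary w' (bary f' p) (bary (endpoint f' w') q) \<le> (dist (\<phi> ?f p) (\<phi> (endpoint ?f v) q))\<^sup>2"
      "sqdist_bary w' (bary f' p) (bary (endpoint f' w') q) < (dist (\<phi> ?f p) (\<phi> (endpoint ?f v) q))\<^sup>2 \<or>
        (\<exists>u x. v = u @ w' @ x \<and> f' = endpoint ?f u)"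
      using reduce_to_strip[OF \<phi> f sub False p q'] by metis
    let ?s = "sqdist_bary w' (bary f' p) (bary (endpoint f' w') q)" and ?d = "dist (\<phi> ?f p) (\<phi> (endpoint ?f v) q)"
    have tr: "trail_length (path_edges (walk f' w')) p q \<le> ereal (sqrt ?s)"
      by (rule trail_strip[OF *(1-5)])
    have "sqrt ?s \<le> ?d" using *(6) real_sqrt_le_mono[of ?s "?d\<^sup>2"] by simp
    then have le: "trail_length (path_edges (walk f' w')) p q \<le> ereal ?d"
      using tr by (meson ereal_less_eq(3) order_trans)
    have "trail_length (path_edges (walk f' w')) p q < ereal ?d \<or> path_edges (walk f' w') \<subset> ?L"
      using *(7)
    proof (elim disjE exE conjE)
      assume "?s < ?d\<^sup>2"
      then have "sqrt ?s < ?d" using real_sqrt_less_mono[of ?s "?d\<^sup>2"] by simp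
      then show ?thesis using tr by (meson ereal_less(1) less_ereal.simps(1) order_le_less_trans)
    next
      fix u' x' assume "v = u' @ w' @ x'" "f' = endpoint ?f u'"
      then show ?thesis using proper[of "u @ u'" w' "x' @ x"] *(2,3) w0 by simp
    qed
    then show thesis
      using that[OF landscape_strip[OF *(2,3,1)] reg[OF *(3) _ *(4)] reg[OF *(3) _ *(5)]] le by simp
  qed
qed

lemma competitor:
  assumes f0: "f0 \<in> faces" and d: "distinct (walk f0 w0)" and nd: "\<not> distinct w0"
    and \<phi>: "layout (set (walk f0 w0)) (path_edges (walk f0 w0)) \<phi>"
    and f: "f \<in> set (walk f0 w0)" "p \<in> face f" and g: "g \<in> set (walk f0 w0)" "q \<in> face g"
  obtains L' where "landscape L'" "p \<in> region L'" "q \<in> region L'"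
    "trail_length L' p q \<le> ereal (dist (\<phi> f p) (\<phi> g q))"
    "trail_length L' p q < ereal (dist (\<phi> f p) (\<phi> g q)) \<or> L' \<subset> path_edges (walk f0 w0)"
  using f(1) g(1)
proof (cases rule: in_walk_pairE)
  case (1 u v x)
  show thesis
    by (rule competitor_ordered[OF f0 d nd \<phi> 1(1), of p q])
       (use that f(2) g(2) 1(2,3) in \<open>auto simp del: endpoint_simps\<close>)
next
  case (2 u v x)
  show thesis
    by (rule competitor_ordered[OF f0 d nd \<phi> 2(1), of q p])
       (use that f(2) g(2) 2(2,3) in \<open>auto simp: trail_length_commute[of _ q p] dist_commute[of "\<phi> (endpoint f0 u) q"] simp del: endpoint_simps\<close>)
qed

text \<open>The squared distance is determined by the infix between the two faces.\<close>

lemma layout_dist_unique: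
  assumes f0: "f0 \<in> faces"
    and \<phi>: "layout (set (walk f0 w0)) (path_edges (walk f0 w0)) \<phi>"
    and \<psi>: "layout (set (walk f0 w0)) (path_edges (walk f0 w0)) \<psi>"
    and f: "f \<in> set (walk f0 w0)" "p \<in> face f" and g: "g \<in> set (walk f0 w0)" "q \<in> face g"
  shows "dist (\<psi> f p) (\<psi> g q) = dist (\<phi> f p) (\<phi> g q)"
proof -
  have ord: "dist (\<psi> (endpoint f0 u) p) (\<psi> (endpoint f0 (u @ v)) q) =
      dist (\<phi> (endpoint f0 u) p) (\<phi> (endpoint f0 (u @ v)) q)"
    if "w0 = u @ v @ x" "p \<in> face (endpoint f0 u)" "q \<in> face (endpoint f0 (u @ v))" for u v x p q
  proof -
    have "(dist (\<theta> (endpoint f0 u) p) (\<theta> (endpoint (endpoint f0 u) v) q))\<^sup>2 =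
        sqdist_bary v (bary (endpoint f0 u) p) (bary (endpoint (endpoint f0 u) v) q)"
      if "layout (set (walk f0 w0)) (path_edges (walk f0 w0)) \<theta>" for \<theta>
      by (rule layout_dist_sq[OF that])
         (use f0 walk_infix[of f0 u v x] \<open>w0 = u @ v @ x\<close> \<open>p \<in> _\<close> \<open>q \<in> _\<close> in auto)
    from this[OF \<phi>] this[OF \<psi>]
    have "(dist (\<psi> (endpoint f0 u) p) (\<psi> (endpoint f0 (u @ v)) q))\<^sup>2 =
      (dist (\<phi> (endpoint f0 u) p) (\<phi> (endpoint f0 (u @ v)) q))\<^sup>2" by simp
    then show ?thesis by (simp only: power2_eq_iff_nonneg zero_le_dist)
  qed
  show ?thesis
    using f(1) g(1)
  proof (cases rule: in_walk_pairE)
    case (1 u v x)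
    then show ?thesis using ord[OF 1(1), of p q] f(2) g(2) by simp
  next
    case (2 u v x)
    then show ?thesis using ord[OF 2(1), of q p] f(2) g(2) by (simp add: dist_commute)
  qed
qed

text \<open>The least distance over all pairs of images bounds the trail length from below, whether
  or not the segment stays inside. A competitor for a minimizing pair is at least as good, so
  validity forces equality, and then the competitor is a proper sublandscape.\<close>

lemma not_valid_walk:
  assumes f0: "f0 \<in> faces" and d: "distinct (walk f0 w0)" and nd: "\<not> distinct w0"
  shows "\<not> valid (path_edges (walk f0 w0))"
proof
  let ?L = "path_edges (walk f0 w0)" and ?F = "set (walk f0 w0)"
  assume "valid ?L"
  then obtain p q where L: "landscape ?L" and pq: "p \<in> region ?L" "q \<in> region ?L"
    and val: "\<And>L'. landscape L' \<Longrightarrow> L' \<noteq> ?L \<Longrightarrow> p \<in> region L' \<Longrightarrow> q \<in> region L' \<Longrightarrow>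
      trail_length ?L p q \<le> trail_length L' p q \<and>
      (trail_length ?L p q = trail_length L' p q \<longrightarrow> \<not> sublandscape L' ?L)"
    unfolding valid_def by blast
  have U: "\<Union>?L = ?F" by (rule Union_path_edges_walk) (use nd in auto)
  obtain \<phi> where "layout {1..8} ?L \<phi>" using landscape_layout[OF L] .
  then have \<phi>: "layout ?F ?L \<phi>"
    using layout_mono set_walk[OF f0] unfolding faces_def by blast
  define S where "S = {(f, g). f \<in> ?F \<and> g \<in> ?F \<and> p \<in> face f \<and> q \<in> face g}"
  define D where "D = (\<lambda>(f, g). dist (\<phi> f p) (\<phi> g q)) ` S"
  have "S \<subseteq> ?F \<times> ?F" by (auto simp: S_def)
  then have fin: "finite D" unfolding D_def by (meson finite_imageI finite_SigmaI finite_subset List.finite_set)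
  have "D \<noteq> {}" using pq unfolding region_def U by (auto simp: D_def S_def)
  then have "Min D \<in> D" using fin by simp
  then obtain f g where fg: "f \<in> ?F" "g \<in> ?F" "p \<in> face f" "q \<in> face g" "Min D = dist (\<phi> f p) (\<phi> g q)"
    unfolding D_def S_def by auto
  have low: "ereal (Min D) \<le> trail_length ?L p q"
    unfolding trail_length_def U
  proof (rule Inf_greatest)
    fix r assume "r \<in> {ereal (dist (\<psi> f p) (\<psi> g q)) |\<psi> f g. layout ?F ?L \<psi> \<and> f \<in> ?F \<and> g \<in> ?F \<and>
      p \<in> face f \<and> q \<in> face g \<and> closed_segment (\<psi> f p) (\<psi> g q) \<subseteq> (\<Union>h\<in>?F. \<psi> h ` face h)}"
    then obtain \<psi> f g where r: "r = ereal (dist (\<psi> f p) (\<psi> g q))" "layout ?F ?L \<psi>" "f \<in> ?F" "g \<in> ?F"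
      "p \<in> face f" "q \<in> face g" by blast
    have "dist (\<psi> f p) (\<psi> g q) = dist (\<phi> f p) (\<phi> g q)"
      by (rule layout_dist_unique[OF f0 \<phi> r(2,3,5,4,6)])
    then have "dist (\<psi> f p) (\<psi> g q) \<in> D" using r by (auto simp: D_def S_def)
    then show "ereal (Min D) \<le> r" using fin r(1) by simp
  qed
  obtain L' where L': "landscape L'" "p \<in> region L'" "q \<in> region L'"
    "trail_length L' p q \<le> ereal (Min D)" "trail_length L' p q < ereal (Min D) \<or> L' \<subset> ?L"
    using competitor[OF f0 d nd \<phi> fg(1,3,2,4)] unfolding fg(5) by metis
  \<comment> \<open>If the competitor is not a proper subset, its trail length is below
    \<open>Min D\<close>, which \<open>low\<close> excludes for the landscape itself.\<close>
  have ne: "L' \<noteq> ?L" using L'(5) low by auto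
  have eq: "trail_length ?L p q = trail_length L' p q" "trail_length L' p q = ereal (Min D)"
    using val[OF L'(1) ne L'(2,3)] low L'(4) by auto
  then have "L' \<subset> ?L" using L'(5) by auto
  then have "sublandscape L' ?L" unfolding sublandscape_def using L L'(1) by blast
  then show False using val[OF L'(1) ne L'(2,3)] eq by blast
qed

text \<open>Consecutive faces are adjacent, hence related by a flip, and the flips supply the
  letters.\<close>

lemma path_is_walk:
  assumes "fs \<noteq> []" "path_edges fs \<subseteq> N" "N \<subseteq> {{f, g} | f g. f \<in> faces \<and> g \<in> faces \<and> adjacent f g}"
  obtains w where "fs = walk (hd fs) w"
proof -
  have "\<exists>w. fs = walk (hd fs) w"
    using assms(1,2)
  proof (induction fs)
    case (Cons f fs)
    show ?case
    proof (cases fs)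
      case Nil
      then show ?thesis by (intro exI[of _ "[]"]) simp
    next
      case (Cons g gs)
      then have "{f, g} \<in> N" "path_edges fs \<subseteq> N"
        using Cons.prems(2) by (auto simp: path_edges_def)
      then obtain f' g' where "{f, g} = {f', g'}" "f' \<in> faces" "g' \<in> faces" "adjacent f' g'"
        using assms(3) by blast
      moreover have "adjacent f' g' \<Longrightarrow> adjacent g' f'" by (simp add: adjacent_def conj_commute)
      ultimately have "f \<in> faces" "g \<in> faces" "adjacent f g" by (auto simp: doubleton_eq_iff)
      then obtain k where "g = flip f k" using adjacent_iff by blast
      moreover obtain w where "fs = walk g w"
        using Cons.IH \<open>path_edges fs \<subseteq> N\<close> Cons by auto
      ultimately show ?thesis by (intro exI[of _ "k # w"]) simp
    qed
  qed simp
  then show thesis using that by blast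
qed

section \<open>Admissible labelings\<close>

text \<open>Rotates the labels 2, 4, 6 around the first face, and their antipodes 7, 5, 3 along with them.\<close>

definition rot :: "nat \<Rightarrow> nat" where
  "rot = id(2 := 4, 4 := 6, 6 := 2, 3 := 7, 7 := 5, 5 := 3)"

lemma rot_permutes: "rot permutes {1..8}"
proof (rule bij_imp_permutes)
  have im: "rot ` {1..8} = {1..8}"
    unfolding faces_def[symmetric] faces_eq by (auto simp: rot_def)
  moreover have "inj_on rot {1..8}"
    by (rule eq_card_imp_inj_on) (simp_all only: im finite_atLeastAtMost)
  ultimately show "bij_betw rot {1..8} {1..8}" by (simp add: bij_betw_def)
  show "rot x = x" if "x \<notin> {1..8}" for x
    using that by (auto simp: rot_def)
qed

lemma ccw_around_rotate: "ccw_around f h k g \<longleftrightarrow> ccw_around f g h k"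
proof -
  have "cross3 (z - y) (x - y) = cross3 (y - x) (z - x)" for x y z :: "real ^ 3"
    by (simp add: cross3_def vec_eq_iff forall_3 algebra_simps)
  then show ?thesis unfolding ccw_around_def by simp
qed

text \<open>\<open>rot\<close> preserves antipodal pairs and permutes 2, 4, 6 cyclically, so the
  rotational order is kept.\<close>

lemma admissible_rot:
  assumes "admissible n"
  shows "admissible (n \<circ> rot)"
proof -
  have "opposite (n (rot b)) (n (rot c))" if "b \<in> {1..8}" "c \<in> {1..8}" "b + c = 9" for b c
  proof -
    have "rot b \<in> {1..8}" "rot c \<in> {1..8}"
      using that permutes_in_image[OF rot_permutes] by blast+
    moreover have c: "c = 9 - b" using that by simp
    have "b \<in> faces" using that by (simp add: faces_def)
    then have "rot b + rot c = 9"
      unfolding c by (cases rule: face_cases) (simp_all add: rot_def)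
    ultimately show ?thesis using assms unfolding admissible_def by blast
  qed
  moreover have "rot 1 = 1" "rot 2 = 4" "rot 4 = 6" "rot 6 = 2" by (simp_all add: rot_def)
  ultimately show ?thesis
    using assms permutes_compose[OF rot_permutes, of n] ccw_around_rotate[of "n 1" "n 4" "n 6" "n 2"]
    unfolding admissible_def by simp
qed

lemma flip_antipode: "f \<in> faces \<Longrightarrow> flip (9 - f) k = 9 - flip f k"
  by (erule face_cases; cases k; simp add: flip.simps)

text \<open>Changing all three signs leads to the opposite face.\<close>

lemma flip3_antipode:
  "f \<in> faces \<Longrightarrow> distinct [a, b, c] \<Longrightarrow> flip (flip (flip f a) b) c = 9 - f"
  by (erule face_cases; cases a; cases b; cases c; simp add: flip.simps)

lemma flip2_antipode:
  assumes f: "f \<in> faces" and d: "distinct [a, b, c]"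
  shows "flip (flip f a) b = 9 - flip f c"
  using flip3_antipode[OF assms] flip_flip[of "flip (flip f a) b" c] flip_antipode[OF f, of c] f by simp

text \<open>The labels 2, 4, 6 mark the three neighbours and so name the three axes; 3, 5, 8 are
  then fixed as opposites of 6, 4, 1.\<close>

lemma admissible_axes:
  assumes n: "admissible n"
  obtains a b c where "n 1 \<in> faces" "distinct [a, b, c]"
    "n 2 = flip (n 1) a" "n 4 = flip (n 1) b" "n 6 = flip (n 1) c"
    "n 3 = flip (flip (n 1) a) b" "n 5 = flip (flip (n 1) a) c" "n 8 = 9 - n 1"
proof -
  have perm: "n permutes faces" using n unfolding admissible_def faces_def by blast
  then have nf: "n i \<in> faces" if "i \<in> faces" for i using permutes_in_image that by metis
  have in_faces: "1 \<in> faces" "2 \<in> faces" "3 \<in> faces" "4 \<in> faces" "5 \<in> faces" "6 \<in> faces" "8 \<in> faces"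
    by (simp_all add: faces_def)
  have opp: "n b + n c = 9" if "b \<in> faces" "c \<in> faces" "b + c = 9" for b c
    using n that opposite_iff[of "n b" "n c"] nf[OF that(1)] nf[OF that(2)]
    unfolding admissible_def faces_def by blast
  have adj: "adjacent (n 1) (n 2)" "adjacent (n 1) (n 4)" "adjacent (n 1) (n 6)"
    using n unfolding admissible_def by blast+
  obtain a b c where abc: "n 2 = flip (n 1) a" "n 4 = flip (n 1) b" "n 6 = flip (n 1) c"
    using adj adjacent_iff nf in_faces by metis
  have "n i \<noteq> n j" if "i \<noteq> j" for i j using permutes_inj[OF perm] that by (simp add: inj_eq)
  from this[of 2 4] this[of 2 6] this[of 4 6] have d: "distinct [a, b, c]" using abc by auto
  have n1: "n 1 \<in> faces" using nf in_faces by blast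
  show thesis
  proof (rule that[OF n1 d abc])
    show "n 3 = flip (flip (n 1) a) b"
      using opp[of 3 6] in_faces flip2_antipode[OF n1 d] abc(3) by simp
    have "distinct [a, c, b]" using d by auto
    then show "n 5 = flip (flip (n 1) a) c"
      using opp[of 5 4] in_faces flip2_antipode[OF n1, of a c b] abc(2) by simp
    show "n 8 = 9 - n 1" using opp[of 8 1] in_faces by simp
  qed
qed

text \<open>Rotating the labeling gives the first neighbour crossed into the label 2. A second
  letter then leads to label 3 or 5, and a third one to label 8.\<close>

lemma strip_is_special:
  assumes n: "admissible n" and w: "distinct w" "w \<noteq> []"
  shows "\<exists>m k. admissible m \<and> m 1 = n 1 \<and> k \<in> {1..9} \<and> path_edges (walk (n 1) w) = special_landscape m k"
proof -
  have rot: "rot (Suc 0) = Suc 0" "rot 2 = 4" "rot 4 = 6" "rot 6 = 2" "rot 5 = 3" by (simp_all add: rot_def)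
  obtain a b c where d: "distinct [a, b, c]" and w3: "w = [a] \<or> w = [a, b] \<or> w = [a, b, c]"
    using distinct_word_cases[OF w] by blast
  obtain m where m: "admissible m" "m 1 = n 1" "m 2 = flip (n 1) a"
  proof -
    obtain a' b' c' where n': "distinct [a', b', c']"
      "n 2 = flip (n 1) a'" "n 4 = flip (n 1) b'" "n 6 = flip (n 1) c'"
      using admissible_axes[OF n] by metis
    have "a \<in> {a', b', c'}" using UNIV_ax_distinct[OF n'(1)] by blast
    then consider "a = a'" | "a = b'" | "a = c'" by blast
    then show thesis
    proof cases
      case 1
      then show thesis using that[of n] n n' by simp
    next
      case 2
      then show thesis using that[of "n \<circ> rot"] admissible_rot[OF n] n' rot by simp
    next
      case 3
      then show thesis
        using that[of "n \<circ> rot \<circ> rot"] admissible_rot[OF admissible_rot[OF n]] n' rot by simp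
    qed
  qed
  obtain a' b' c' where m': "n 1 \<in> faces" "distinct [a', b', c']"
    "m 2 = flip (n 1) a'" "m 3 = flip (flip (n 1) a') b'" "m 5 = flip (flip (n 1) a') c'" "m 8 = 9 - n 1"
    using admissible_axes[OF m(1)] m(2) by metis
  have a': "a' = a" using m(3) m'(1,3) flip_inj by metis
  have bc: "b' = b \<and> c' = c \<or> b' = c \<and> c' = b"
  proof -
    have "b' \<in> {a, b, c}" "c' \<in> {a, b, c}" using UNIV_ax_distinct[OF d] by blast+
    then show ?thesis using m'(2) a' by auto
  qed
  have flip3 [simplified]: "flip (flip (flip (n 1) a) b) c = m 8" using flip3_antipode[OF m'(1) d] m'(6) by simp
  have ex: "\<exists>m k. admissible m \<and> m 1 = n 1 \<and> k \<in> {1..9} \<and> path_edges (walk (n 1) w) = special_landscape m k"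
    if "admissible m" "m 1 = n 1" "k \<in> {1..9}" "path_edges (walk (n 1) w) = special_landscape m k" for m k
    using that by blast
  note sp = special_landscape_def m(2)[simplified] m(3)[simplified] m'(3-5)[simplified] a'
  show ?thesis
    using w3
  proof (elim disjE)
    assume "w = [a]"
    then show ?thesis by (intro ex[OF m(1,2), of 1]) (simp_all add: sp)
  next
    assume w: "w = [a, b]"
    show ?thesis
      using bc
    proof (elim disjE conjE)
      \<comment> \<open>\<open>rot\<close> sends 6 and 5 to 2 and 3, so landscape 3 of
        \<open>m \<circ> rot\<close> runs through the labels 1, 2, 3 of \<open>m\<close>.\<close>
      assume "b' = b" "c' = c"
      then show ?thesis
        using w m'(4) a' m
        by (intro ex[OF admissible_rot[OF m(1)], of 3]) (simp_all add: special_landscape_def rot)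
    next
      assume "b' = c" "c' = b"
      then show ?thesis using w by (intro ex[OF m(1,2), of 2]) (simp_all add: sp)
    qed
  next
    assume w: "w = [a, b, c]"
    show ?thesis
      using bc
    proof (elim disjE conjE)
      assume "b' = b" "c' = c"
      then show ?thesis using w by (intro ex[OF m(1,2), of 5]) (simp_all add: sp flip3)
    next
      assume "b' = c" "c' = b"
      then show ?thesis using w by (intro ex[OF m(1,2), of 8]) (simp_all add: sp flip3)
    qed
  qed
qed

theorem theorem5:
  fixes n :: "nat \<Rightarrow> nat" and i :: nat and L :: "nat set set"
  assumes "admissible n"
    and "i \<in> {1..8}"
    and "landscape_from_to L (n 1) (n i)"
    and "\<not> (\<exists>m k. admissible m \<and> m 1 = n 1 \<and> k \<in> {1..9} \<and> L = special_landscape m k)"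
  shows "\<not> valid L"
proof -
  obtain fs where fs: "distinct fs" "length fs \<ge> 2" "L = path_edges fs" "hd fs = n 1" and L: "landscape L"
    using assms(3) unfolding landscape_from_to_def by blast
  \<comment> \<open>The list witnessing \<open>landscape L\<close> may differ from
    \<open>fs\<close>, but both have the same edge set, so the net contains the edges of
    \<open>fs\<close>.\<close>
  from L obtain N where N: "net N" "path_edges fs \<subseteq> N"
    unfolding landscape_def fs(3) by metis
  have adj: "N \<subseteq> {{f, g} | f g. f \<in> faces \<and> g \<in> faces \<and> adjacent f g}"
    using N(1) unfolding net_def faces_def by blast
  have "fs \<noteq> []" using fs(2) by auto
  then obtain w where w: "fs = walk (n 1) w"
    using path_is_walk[OF _ N(2) adj] fs(4) by auto
  have "n 1 \<in> faces" by (rule admissible_axes[OF assms(1)])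
  moreover have "w \<noteq> []" using fs(2) w by auto
  then have "\<not> distinct w" using strip_is_special[OF assms(1)] assms(4) fs(3) w by metis
  ultimately show ?thesis
    using not_valid_walk fs(1,3) w by blast
qed

end
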